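(* Let $S \subset F$ be a measurable subset such that $0 < \mathfrak{m}(S) < \infty$ and $$\int_{F \setminus B(0,q^{n})} |\widehat{\mathbf{1}_S}|^2\, \mathrm{d}\mathfrak{m} = O(q^{-n}) \quad \text{as } n \to \infty.$$ Then the determinantal point process on $F$ induced by the correlation kernel $K_S(x,y) = \widehat{\mathbf{1}_S}(x-y)$, $x,y\in F$, is number rigid.
   Context: $F$ is a non-discrete non-Archimedean local field, with ring of integers $\mathcal{O}_F = \{x : |x| \le 1\}$, maximal ideal $\mathcal{M}_F = \{x : |x|<1\} = \varpi\mathcal{O}_F$, and residue field $\mathcal{O}_F/\mathcal{M}_F$ of cardinality $q = p^e$ ($p$ prime). The absolute value $|\cdot|$ is normalized by $|\varpi| = q^{-1}$. $\mathfrak{m}$ is the Haar measure on the additive group $F$ with $\mathfrak{m}(\mathcal{O}_F)=1$. $B(x,r) = \{y \in F : |y-x| \le r\}$ denotes the closed ball. $\mathbf{1}_S$ is the indicator function of $S$. Fourier transform: fix a character $\chi$ of the additive group $F$ (continuous homomorphism into the unit circle) with $\chi \equiv 1$ on $\mathcal{O}_F$ and $\chi$ not constant on $\varpi^{-1}\mathcal{O}_F$. For $f \in L^1(F,\mathfrak{m})$, $\widehat{f}(y) = \int_F f(x)\chi(xy)\,\mathrm{d}\mathfrak{m}(x)$. Point processes: a random point process $\mathcal{X}$ on $F$ is a random locally finite subset of $F$. It is a determinantal point process induced by a correlation kernel $K : F\times F \to \mathbb{C}$ if for every positive integer $n$ and every compactly supported bounded measurable $\varphi : F^n \to \mathbb{C}$,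 $$\mathbb{E}\Big(\sum^{*}_{x_1,\dots,x_n \in \mathcal{X}} \varphi(x_1,\dots,x_n)\Big) = \int_{F^n} \varphi(y_1,\dots,y_n)\det(K(y_i,y_j))_{1\le i,j\le n}\,\mathrm{d}\mathfrak{m}(y_1)\cdots \mathrm{d}\mathfrak{m}(y_n),$$ where $\sum^*$ is the sum over ordered $n$-tuples of distinct points of $\mathcal{X}$. For measurable $S$ with $0<\mathfrak{m}(S)<\infty$, the kernel $K_S$ induces a determinantal point process (Macchi–Soshnikov theorem). Number rigidity: $\mathcal{X}$ is number rigid if for every bounded open subset $B \subset F$, the number $\#(\mathcal{X}\cap B)$ is almost surely determined by $\mathcal{X}\setminus B$, i.e. it is measurable with respect to the completion of the $\sigma$-algebra generated by $\mathcal{X}\setminus B$. *)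

theory Defs
  imports
    "HOL-Probability.Probability"
    "HOL-Library.Landau_Symbols"
    "Jordan_Normal_Form.Determinant"
begin

section \<open>Non-Archimedean local fields\<close>

text \<open>
  A non-discrete, locally compact field whose topology comes from a multiplicative ultrametric
  absolute value \<open>absval\<close> (the constant \<open>norm\<close> is reserved for real normed spaces). Closed
  balls \<open>cball x r\<close> are then the sets
  \<open>B(x,r) = {y. absval (y - x) \<le> r}\<close>. Continuity of the field operations follows from the axioms.
\<close>

class nonarch_valued_local_field = field + metric_space +
  fixes absval :: "'a \<Rightarrow> real"
  assumes dist_absval: "dist x y = absval (x - y)"
    and absval_mult: "absval (x * y) = absval x * absval y"
    and absval_ultrametric: "absval (x + y) \<le> max (absval x) (absval y)"
    and non_discrete: "\<not> open {0}"
    and locally_compact: "\<exists>U K. open U \<and> x \<in> U \<and> U \<subseteq> K \<and> compact K"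
begin

definition integer_ring :: "'a set"  (\<open>\<O>\<^sub>F\<close>)
  where "\<O>\<^sub>F = {x. absval x \<le> 1}"

definition maximal_ideal :: "'a set"  (\<open>\<M>\<^sub>F\<close>)
  where "\<M>\<^sub>F = {x. absval x < 1}"

definition uniformizer :: "'a \<Rightarrow> bool"
  where "uniformizer \<pi> \<longleftrightarrow> \<M>\<^sub>F = (\<lambda>x. \<pi> * x) ` \<O>\<^sub>F"

definition residue_field :: "'a set set"
  where "residue_field = \<O>\<^sub>F // {(x, y). x \<in> \<O>\<^sub>F \<and> y \<in> \<O>\<^sub>F \<and> x - y \<in> \<M>\<^sub>F}"

end

definition residue_card :: "'a::nonarch_valued_local_field itself \<Rightarrow> nat"
  where "residue_card _ = card (residue_field :: 'a set set)"

text \<open>The normalization of the absolute value. A uniformizer always exists.\<close>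

class nonarch_local_field = nonarch_valued_local_field +
  assumes absval_uniformizer: "uniformizer \<pi> \<Longrightarrow>
      absval \<pi> = inverse (real (card (residue_field :: 'a set set)))"

text \<open>
  Regularity need not be required: \<open>F\<close> is \<open>\<sigma>\<close>-compact and metrizable, so that every Borel measure
  that is finite on compact sets is regular.
\<close>

definition haar_measure :: "'a::nonarch_local_field measure \<Rightarrow> bool"
  where "haar_measure m \<longleftrightarrow>
    sets m = sets borel \<and>
    (\<forall>x. \<forall>A\<in>sets m. emeasure m ((\<lambda>y. x + y) ` A) = emeasure m A) \<and>
    (\<forall>K. compact K \<longrightarrow> emeasure m K < \<infinity>) \<and>
    (\<forall>U. open U \<and> U \<noteq> {} \<longrightarrow> 0 < emeasure m U)"

definition normalized_haar_measure :: "'a::nonarch_local_field measure \<Rightarrow> bool"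
  where "normalized_haar_measure m \<longleftrightarrow> haar_measure m \<and> emeasure m \<O>\<^sub>F = 1"

definition additive_character :: "('a::nonarch_local_field \<Rightarrow> complex) \<Rightarrow> bool"
  where "additive_character \<psi> \<longleftrightarrow>
    continuous_on UNIV \<psi> \<and> (\<forall>x. cmod (\<psi> x) = 1) \<and> (\<forall>x y. \<psi> (x + y) = \<psi> x * \<psi> y)"

definition fourier ::
  "'a::nonarch_local_field measure \<Rightarrow> ('a \<Rightarrow> complex) \<Rightarrow> ('a \<Rightarrow> complex) \<Rightarrow> 'a \<Rightarrow> complex"
  where "fourier m \<psi> f y = (\<integral>x. f x * \<psi> (x * y) \<partial>m)"

definition kernel_of_set ::
  "'a::nonarch_local_field measure \<Rightarrow> ('a \<Rightarrow> complex) \<Rightarrow> 'a set \<Rightarrow> 'a \<Rightarrow> 'a \<Rightarrow> complex"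
  where "kernel_of_set m \<psi> S x y = fourier m \<psi> (indicator S) (x - y)"


section \<open>Point processes\<close>

definition configurations :: "'a::metric_space set set"
  where "configurations = {A. \<forall>K. compact K \<longrightarrow> finite (A \<inter> K)}"

text \<open>The usual \<open>\<sigma>\<close>-algebra on configurations, generated by the counting variables.\<close>

definition configuration_space :: "'a::metric_space set measure"
  where "configuration_space = sigma configurations
    {{A \<in> configurations. card (A \<inter> C) = k} | C k. C \<in> sets borel \<and> bounded C}"

definition point_process :: "'w measure \<Rightarrow> ('w \<Rightarrow> 'a::metric_space set) \<Rightarrow> bool"
  where "point_process P X \<longleftrightarrow> prob_space P \<and> X \<in> measurable P configuration_space"

text \<open>
  Points of \<open>F^n\<close> are the elements of \<open>{..<n} \<rightarrow>\<^sub>E UNIV\<close>. A function on \<open>F^n\<close> has compact support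
  iff it vanishes outside \<open>K^n\<close> for some compact \<open>K \<subseteq> F\<close>. Since the integrals of the library are
  total functions, the existence of both sides of the defining identity is stated explicitly.
\<close>

definition compactly_supported_test_function ::
  "'a::metric_space measure \<Rightarrow> nat \<Rightarrow> ((nat \<Rightarrow> 'a) \<Rightarrow> complex) \<Rightarrow> bool"
  where "compactly_supported_test_function m n \<phi> \<longleftrightarrow>
    \<phi> \<in> borel_measurable (\<Pi>\<^sub>M i\<in>{..<n}. m) \<and>
    bounded (\<phi> ` ({..<n} \<rightarrow>\<^sub>E UNIV)) \<and>
    (\<exists>K. compact K \<and> (\<forall>x \<in> {..<n} \<rightarrow>\<^sub>E UNIV. \<phi> x \<noteq> 0 \<longrightarrow> x \<in> {..<n} \<rightarrow>\<^sub>E K))"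

definition determinantal_point_process ::
  "'a::metric_space measure \<Rightarrow> ('a \<Rightarrow> 'a \<Rightarrow> complex) \<Rightarrow> 'w measure \<Rightarrow> ('w \<Rightarrow> 'a set) \<Rightarrow> bool"
  where "determinantal_point_process m K P X \<longleftrightarrow>
    point_process P X \<and>
    (\<forall>n>0. \<forall>\<phi>. compactly_supported_test_function m n \<phi> \<longrightarrow>
      (let \<rho> = (\<lambda>y. \<phi> y * Determinant.det (Matrix.mat n n (\<lambda>(i, j). K (y i) (y j))))
       in integrable (\<Pi>\<^sub>M i\<in>{..<n}. m) \<rho> \<and>
          has_bochner_integral P
            (\<lambda>\<omega>. \<Sum>\<^sub>\<infinity>x | x \<in> {..<n} \<rightarrow>\<^sub>E X \<omega> \<and> inj_on x {..<n}. \<phi> x)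
            (\<integral>y. \<rho> y \<partial>(\<Pi>\<^sub>M i\<in>{..<n}. m))))"

text \<open>
  The completion of a sub-\<open>\<sigma>\<close>-algebra \<open>G\<close> with respect to \<open>P\<close> adjoins all subsets of \<open>P\<close>-null sets
  of the ambient space. Completing the restriction of \<open>P\<close> to \<open>G\<close> would adjoin only the subsets of
  null sets belonging to \<open>G\<close>; this is too small for ``almost surely determined'', which has to
  disregard arbitrary \<open>P\<close>-null events.
\<close>

definition completed_subalgebra :: "'w measure \<Rightarrow> 'w measure \<Rightarrow> 'w measure"
  where "completed_subalgebra P G = sigma (space P) (sets G \<union> null_sets (completion P))"

definition number_rigid :: "'w measure \<Rightarrow> ('w \<Rightarrow> 'a::metric_space set) \<Rightarrow> bool"
  where "number_rigid P X \<longleftrightarrow>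
    (\<forall>B. open B \<and> bounded B \<longrightarrow>
      (\<lambda>\<omega>. card (X \<omega> \<inter> B)) \<in> measurable
        (completed_subalgebra P
          (vimage_algebra (space P) (\<lambda>\<omega>. X \<omega> - B) configuration_space))
        (count_space UNIV))"

end

theory Submission
  imports Defs
begin

text \<open>
  Write \<open>N\<^sub>j\<close> for the number of points in the ball \<open>B\<^sub>j = B(0, q\<^sup>j)\<close>, \<open>f\<close> for the Fourier transform of
  the indicator of \<open>S\<close>, and \<open>T\<^sub>j\<close> for the integral of \<open>\<bar>f\<bar>\<^sup>2\<close> over the complement of \<open>B\<^sub>j\<close>. The second
  correlation function gives, for \<open>i \<le> j\<close>,
  \<open>Cov(N\<^sub>i, N\<^sub>j) = \<integral>\<^bsub>B\<^sub>i\<^esub> (m(S) - \<integral>\<^bsub>B\<^sub>j\<^esub> \<bar>f(x - y)\<bar>\<^sup>2 dy) dx\<close>.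
  For \<open>x\<close> in \<open>B\<^sub>i\<close> the ultrametric inequality makes \<open>B\<^sub>j\<close> invariant under translation by \<open>x\<close>, so that the
  inner integral does not depend on \<open>x\<close>; and \<open>m(S) = \<integral>\<bar>f\<bar>\<^sup>2\<close> by Plancherel's theorem. Hence
  \<open>Cov(N\<^sub>i, N\<^sub>j) = q\<^sup>i T\<^sub>j\<close> exactly (\<open>covariance_count\<close>), and the decay hypothesis turns this into
  \<open>O(q\<^bsup>i - j\<^esup>)\<close>: the counts in the successive balls have bounded variance and are exponentially
  decorrelated.

  This is what the method of Ghosh and Peres needs. Averages of the centred variables
  \<open>N\<^sub>j - E N\<^sub>j\<close> over \<open>n\<close> successive balls have second moment \<open>O(1/n)\<close>, so that they tend to \<open>0\<close> almost surely
  along a subsequence (\<open>weakly_correlated_average_tendsto_0\<close>). Let \<open>B\<close> be bounded and let all the balls used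
  contain \<open>B\<close>. Then each \<open>N\<^sub>j\<close> is the number of points in \<open>B\<close> plus the number of points of the process outside \<open>B\<close>
  that lie in \<open>B\<^sub>j\<close>. The first summand is the same for all \<open>j\<close>, hence is almost surely the limit of averages
  of \<open>E N\<^sub>j\<close> minus the second summand, and these averages depend only on the process outside \<open>B\<close>
  (\<open>number_rigid_of_decay\<close>).

  Plancherel's theorem for the indicator of \<open>S\<close> is obtained by hand. A nontrivial character integrates to
  \<open>0\<close> over a ball, so Fubini's theorem turns \<open>\<integral>\<^bsub>B\<^sub>n\<^esub> \<bar>f\<bar>\<^sup>2\<close> into the integral over \<open>S\<close> of the relative density of
  \<open>S\<close> in balls of radius \<open>q\<^sup>-\<^sup>n\<close> (\<open>integral_cball_norm_fhat_sq\<close>), which tends to \<open>m(S)\<close> by inner regularity of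
  the Haar measure (\<open>tendsto_integral_local_density\<close>).
\<close>

section \<open>Topology of non-Archimedean local fields\<close>

lemma absval_zero [simp]: "absval (0::'a::nonarch_valued_local_field) = 0"
  by (metis diff_self dist_absval dist_self)

lemma absval_nonneg [simp]: "0 \<le> absval (x::'a::nonarch_valued_local_field)"
  by (metis diff_zero dist_absval zero_le_dist)

lemma absval_eq_0_iff [simp]: "absval (x::'a::nonarch_valued_local_field) = 0 \<longleftrightarrow> x = 0"
  by (metis diff_zero dist_absval dist_eq_0_iff)

lemma absval_pos_iff [simp]: "0 < absval (x::'a::nonarch_valued_local_field) \<longleftrightarrow> x \<noteq> 0"
  by (simp add: less_le)

lemma absval_one [simp]: "absval (1::'a::nonarch_valued_local_field) = 1"
proof -
  have "absval (1::'a) * absval (1::'a) = absval (1::'a)"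
    by (metis absval_mult mult_1)
  then show ?thesis by simp
qed

lemma absval_minus [simp]: "absval (- (x::'a::nonarch_valued_local_field)) = absval x"
  by (metis diff_0 dist_absval dist_commute diff_zero)

lemma absval_minus_commute: "absval ((x::'a::nonarch_valued_local_field) - y) = absval (y - x)"
  by (metis absval_minus minus_diff_eq)

lemma absval_triangle: "absval ((x::'a::nonarch_valued_local_field) + y) \<le> absval x + absval y"
  using absval_ultrametric[of x y] absval_nonneg[of x] absval_nonneg[of y] by linarith

lemma absval_diff_le: "absval ((x::'a::nonarch_valued_local_field) - y) \<le> max (absval x) (absval y)"
  using absval_ultrametric[of x "- y"] by simp

lemma absval_power: "absval ((x::'a::nonarch_valued_local_field) ^ n) = absval x ^ n"
  by (induction n) (auto simp: absval_mult)

lemma absval_inverse: "absval (inverse (x::'a::nonarch_valued_local_field)) = inverse (absval x)"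
proof (cases "x = 0")
  case False
  have "absval x * absval (inverse x) = 1"
    using False by (simp flip: absval_mult)
  then show ?thesis using False by (simp add: field_simps)
qed simp

lemma absval_divide: "absval ((x::'a::nonarch_valued_local_field) / y) = absval x / absval y"
  unfolding divide_inverse absval_mult absval_inverse ..

lemma mem_cball_absval: "(y::'a::nonarch_valued_local_field) \<in> cball x r \<longleftrightarrow> absval (y - x) \<le> r"
  by (metis mem_cball dist_absval absval_minus_commute)

lemma mem_cball_0_absval: "(y::'a::nonarch_valued_local_field) \<in> cball 0 r \<longleftrightarrow> absval y \<le> r"
  unfolding mem_cball_absval by simp

text \<open>
  A ball about the origin is a subgroup. This makes integrals over it invariant under translation by its
  elements, both for characters and for the squared kernel.
\<close>

lemma cball_0_add_iff:
  fixes x y :: "'a::nonarch_valued_local_field"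
  assumes "x \<in> cball 0 r"
  shows "x + y \<in> cball 0 r \<longleftrightarrow> y \<in> cball 0 r"
  using assms absval_ultrametric[of x y] absval_ultrametric[of "- x" "x + y"]
  unfolding mem_cball_0_absval by (simp add: max_def split: if_splits)

lemma continuous_on_mult_absval:
  fixes f g :: "'b::topological_space \<Rightarrow> 'a::nonarch_valued_local_field"
  assumes "continuous_on A f" "continuous_on A g"
  shows "continuous_on A (\<lambda>x. f x * g x)"
  unfolding continuous_on
proof
  fix a assume a: "a \<in> A"
  have f: "(f \<longlongrightarrow> f a) (at a within A)" and g: "(g \<longlongrightarrow> g a) (at a within A)"
    using assms a by (auto simp: continuous_on)
  have df: "((\<lambda>x. dist (f x) (f a)) \<longlongrightarrow> 0) (at a within A)"
    and dg: "((\<lambda>x. dist (g x) (g a)) \<longlongrightarrow> 0) (at a within A)"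
    using f g by (simp_all only: tendsto_dist_iff[symmetric])
  have bound: "dist (f x * g x) (f a * g a) \<le> dist (f x) (f a) * dist (g x) (g a)
      + absval (f a) * dist (g x) (g a) + dist (f x) (f a) * absval (g a)" (is "_ \<le> ?r x") for x
  proof -
    have "f x * g x - f a * g a = ((f x - f a) * (g x - g a) + f a * (g x - g a)) + (f x - f a) * g a"
      by (simp add: algebra_simps)
    then have "dist (f x * g x) (f a * g a) \<le> absval ((f x - f a) * (g x - g a))
      + absval (f a * (g x - g a)) + absval ((f x - f a) * g a)"
      using absval_triangle[of "(f x - f a) * (g x - g a) + f a * (g x - g a)" "(f x - f a) * g a"]
        absval_triangle[of "(f x - f a) * (g x - g a)" "f a * (g x - g a)"]
      unfolding dist_absval by simp
    then show ?thesis by (simp add: absval_mult dist_absval)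
  qed
  have "(?r \<longlongrightarrow> 0 * 0 + absval (f a) * 0 + 0 * absval (g a)) (at a within A)"
    by (intro tendsto_intros df dg)
  then have "(?r \<longlongrightarrow> 0) (at a within A)" by simp
  then have "((\<lambda>x. dist (f x * g x) (f a * g a)) \<longlongrightarrow> 0) (at a within A)"
    by (rule tendsto_0_le[where K = 1]) (auto intro!: always_eventually order_trans[OF bound])
  then show "((\<lambda>x. f x * g x) \<longlongrightarrow> f a * g a) (at a within A)"
    by (rule iffD2[OF tendsto_dist_iff])
qed

lemma continuous_on_diff_absval:
  fixes f g :: "'b::topological_space \<Rightarrow> 'a::nonarch_valued_local_field"
  assumes "continuous_on A f" "continuous_on A g"
  shows "continuous_on A (\<lambda>x. f x - g x)"
  unfolding continuous_on
proof
  fix a assume a: "a \<in> A"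
  have df: "((\<lambda>x. dist (f x) (f a)) \<longlongrightarrow> 0) (at a within A)"
    and dg: "((\<lambda>x. dist (g x) (g a)) \<longlongrightarrow> 0) (at a within A)"
    using assms a by (simp_all only: tendsto_dist_iff[symmetric] continuous_on)
  have bound: "dist (f x - g x) (f a - g a) \<le> dist (f x) (f a) + dist (g x) (g a)" (is "_ \<le> ?r x") for x
  proof -
    have "f x - g x - (f a - g a) = (f x - f a) - (g x - g a)" by simp
    then have "dist (f x - g x) (f a - g a) \<le> max (dist (f x) (f a)) (dist (g x) (g a))"
      unfolding dist_absval using absval_diff_le by metis
    then show ?thesis by (smt (verit) zero_le_dist)
  qed
  have "(?r \<longlongrightarrow> 0) (at a within A)"
    using tendsto_add[OF df dg] by simp
  then have "((\<lambda>x. dist (f x - g x) (f a - g a)) \<longlongrightarrow> 0) (at a within A)"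
    by (rule tendsto_0_le[where K = 1]) (auto intro!: always_eventually order_trans[OF bound])
  then show "((\<lambda>x. f x - g x) \<longlongrightarrow> f a - g a) (at a within A)"
    by (rule iffD2[OF tendsto_dist_iff])
qed

text \<open>
  Non-discreteness supplies a contracting element without reference to a uniformizer, so that the topological
  class instances below hold for every field of the class.
\<close>

lemma ex_absval_less_1: "\<exists>c::'a::nonarch_valued_local_field. c \<noteq> 0 \<and> absval c < 1"
proof (rule ccontr)
  assume "\<not> ?thesis"
  then have "open {0::'a}"
    unfolding open_dist by (intro ballI exI[of _ 1]) (auto simp: dist_absval)
  with non_discrete[where 'a = 'a] show False by simp
qed

text \<open>
  Local compactness gives one compact ball about the origin; every other ball is carried into it by
  multiplication with a high power of a contracting element, which has a continuous inverse.
\<close>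

lemma compact_cball_0_absval: "compact (cball (0::'a::nonarch_valued_local_field) r)"
proof -
  obtain U K where UK: "open U" "(0::'a) \<in> U" "U \<subseteq> K" "compact K"
    using locally_compact by metis
  obtain e where e: "e > 0" "cball 0 e \<subseteq> U"
    using UK open_contains_cball by metis
  have e_compact: "compact (cball (0::'a) e)"
    using compact_Int_closed[OF UK(4) closed_cball[of 0 e]] e UK(3) by (simp add: Int_absorb1)
  obtain c :: 'a where c: "c \<noteq> 0" "absval c < 1"
    using ex_absval_less_1 by blast
  have "(\<lambda>k. r * absval c ^ k) \<longlonglongrightarrow> r * 0"
    using c by (intro tendsto_intros LIMSEQ_power_zero) auto
  then have "eventually (\<lambda>k. r * absval c ^ k < e) sequentially"
    using e by (intro order_tendstoD) auto
  then obtain k where k: "r * absval c ^ k < e"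
    by (auto simp: eventually_sequentially)
  have "compact ((\<lambda>x. inverse (c ^ k) * x) ` cball 0 e)"
    by (intro compact_continuous_image e_compact continuous_on_mult_absval continuous_intros)
  moreover have "cball 0 r \<subseteq> (\<lambda>x. inverse (c ^ k) * x) ` cball 0 e"
  proof
    fix x :: 'a assume x: "x \<in> cball 0 r"
    have "absval c ^ k > 0" using c by simp
    then have "absval (c ^ k * x) \<le> e"
      using x k mult_right_mono[of "absval x" r "absval c ^ k"]
      unfolding mem_cball_0_absval absval_mult absval_power mult.commute[of "absval c ^ k"] by linarith
    then show "x \<in> (\<lambda>x. inverse (c ^ k) * x) ` cball 0 e"
      using c by (intro image_eqI[of _ _ "c ^ k * x"])
        (auto simp: mem_cball_0_absval simp del: mem_cball)
  qed
  ultimately show ?thesis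
    using compact_Int_closed closed_cball by (metis Int_absorb1)
qed

text \<open>
  Closed balls are compact, so bounded sequences have convergent subsequences. Together with second countability
  this yields what integration on the field rests on: the Borel sets of a product form the product
  \<open>\<sigma>\<close>-algebra, and finite Borel measures are inner regular.
\<close>

instance nonarch_valued_local_field \<subseteq> heine_borel
proof
  fix f :: "nat \<Rightarrow> 'a"
  assume "bounded (range f)"
  then obtain r where "\<And>n. dist 0 (f n) \<le> r"
    unfolding bounded_any_center[of _ 0] by auto
  then have "\<forall>n. f n \<in> cball 0 r" by simp
  then show "\<exists>l r. strict_mono (r::nat\<Rightarrow>nat) \<and> ((f \<circ> r) \<longlongrightarrow> l) sequentially"
    using compact_cball_0_absval[of r, where 'a='a] unfolding compact_eq_seq_compact_metric seq_compact_def
    by blast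
qed

text \<open>
  The field is a countable union of compact balls, each of them totally bounded; the centres of finite covers
  of these balls at all scales \<open>1/(j + 1)\<close> therefore form a countable dense set.
\<close>

instance nonarch_valued_local_field \<subseteq> second_countable_topology
proof
  have "\<exists>k. finite k \<and> cball (0::'a) (real n) \<subseteq> (\<Union>x\<in>k. ball x (1 / Suc j))" for n j
  proof -
    have "\<forall>\<epsilon>>0. \<exists>k. finite k \<and> cball (0::'a) (real n) \<subseteq> (\<Union>x\<in>k. ball x \<epsilon>)"
      using compact_cball_0_absval compact_eq_totally_bounded by blast
    from this[rule_format, of "1 / Suc j"] show ?thesis by simp
  qed
  then obtain T where T: "\<And>n j. finite (T n j)"
     "\<And>n j. cball (0::'a) (real n) \<subseteq> (\<Union>x\<in>T n j. ball x (1 / Suc j))"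
    by metis
  define \<B> where "\<B> = (\<Union>n. \<Union>j. (\<lambda>x. ball x (1 / Suc j)) ` T n j)"
  have cB: "countable \<B>"
    unfolding \<B>_def by (simp add: countable_finite T)
  have "topological_basis \<B>"
  proof (rule topological_basisI)
    fix B' assume "B' \<in> \<B>" then show "open B'" unfolding \<B>_def by auto
  next
    fix O' and x :: 'a assume O: "open O'" "x \<in> O'"
    then obtain e where e: "e > 0" "ball x e \<subseteq> O'"
      using open_contains_ball by blast
    obtain j where j: "1 / real (Suc j) < e / 2"
      using nat_approx_posE[of "e/2"] e by auto
    obtain n where "dist 0 x \<le> real n" using real_arch_simple by blast
    then obtain t where t: "t \<in> T n j" "x \<in> ball t (1 / Suc j)"
      using T(2)[of n j] by force
    have "ball t (1 / Suc j) \<subseteq> ball x e"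
    proof
      fix y assume "y \<in> ball t (1 / Suc j)"
      then show "y \<in> ball x e"
        using t j dist_triangle[of x y t] by (simp add: dist_commute)
    qed
    then show "\<exists>B'\<in>\<B>. x \<in> B' \<and> B' \<subseteq> O'"
      using t e unfolding \<B>_def by blast
  qed
  then show "\<exists>B::'a set set. countable B \<and> open = generate_topology B"
    using topological_basis_imp_subbasis cB by blast
qed

section \<open>Haar measure of balls and the orthogonality of characters\<close>

locale local_field_fourier =
  fixes m :: "'a::nonarch_local_field measure"
    and \<pi> :: 'a
    and \<psi> :: "'a \<Rightarrow> complex"
    and q :: nat
  assumes q: "q = residue_card TYPE('a)"
    and \<pi>: "uniformizer \<pi>"
    and m: "normalized_haar_measure m"
    and \<psi>: "additive_character \<psi>"
    and \<psi>_trivial: "\<forall>x\<in>\<O>\<^sub>F. \<psi> x = 1"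
    and \<psi>_nontrivial: "\<not> \<psi> constant_on ((\<lambda>x. inverse \<pi> * x) ` \<O>\<^sub>F)"
begin

lemma sets_m [simp, measurable_cong]: "sets m = sets borel"
  using m by (simp add: normalized_haar_measure_def haar_measure_def)

lemma space_m [simp]: "space m = UNIV"
  using sets_eq_imp_space_eq[OF sets_m] by simp

lemma absval_\<pi>: "absval \<pi> = 1 / real q"
  using absval_uniformizer[OF \<pi>] q by (simp add: residue_card_def inverse_eq_divide)

lemma \<pi>_nonzero: "\<pi> \<noteq> 0"
proof
  assume "\<pi> = 0"
  then have "(\<M>\<^sub>F :: 'a set) \<subseteq> {0}"
    using \<pi> by (auto simp: uniformizer_def)
  then show False
    using ex_absval_less_1[where 'a = 'a] by (auto simp: maximal_ideal_def)
qed

text \<open>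
  The normalization \<open>\<bar>\<pi>\<bar> = 1/q\<close> turns \<open>0 < \<bar>\<pi>\<bar> < 1\<close> into \<open>q > 1\<close>. Since an infinite residue field has \<open>card\<close> equal
  to \<open>0\<close>, its finiteness follows as well.
\<close>

lemma q_gt_1: "1 < q"
proof -
  have "1 \<in> (\<O>\<^sub>F :: 'a set)" by (simp add: integer_ring_def)
  then have "\<pi> * 1 \<in> \<M>\<^sub>F"
    using \<pi> unfolding uniformizer_def by blast
  then have "1 / real q < 1"
    by (simp add: maximal_ideal_def absval_\<pi>)
  moreover have "0 < 1 / real q"
    using \<pi>_nonzero absval_\<pi> by (metis absval_pos_iff)
  ultimately show ?thesis by (simp add: divide_less_eq split: if_splits)
qed

text \<open>
  The absolute value skips the interval from \<open>1/q\<close> to \<open>1\<close>, because the maximal ideal is \<open>\<pi>\<close> times the ring of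
  integers.
\<close>

lemma absval_less_1_imp_le: "absval x < 1 \<Longrightarrow> absval x \<le> 1 / real q" for x :: 'a
proof -
  assume "absval x < 1"
  then have "x \<in> (\<lambda>x. \<pi> * x) ` \<O>\<^sub>F"
    using \<pi> by (auto simp: uniformizer_def maximal_ideal_def)
  then obtain y where "x = \<pi> * y" "absval y \<le> 1"
    by (auto simp: integer_ring_def)
  then show ?thesis
    by (simp add: absval_mult absval_\<pi> divide_right_mono)
qed

lemma finite_residue_field: "finite (residue_field :: 'a set set)"
  using q_gt_1 q by (metis card.infinite not_less_zero residue_card_def)

lemma emeasure_translate: "A \<in> sets borel \<Longrightarrow> emeasure m ((+) x ` A) = emeasure m A"
  using m by (simp add: normalized_haar_measure_def haar_measure_def)

lemma emeasure_compact: "compact K \<Longrightarrow> emeasure m K < \<infinity>"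
  using m by (simp add: normalized_haar_measure_def haar_measure_def)

lemma measurable_translate [measurable]: "(+) x \<in> borel_measurable borel" for x :: 'a
proof -
  have "continuous_on UNIV (\<lambda>y. x - (0 - y))"
    by (intro continuous_on_diff_absval continuous_intros)
  then have "continuous_on UNIV ((+) x)" by simp
  then show ?thesis by (rule borel_measurable_continuous_onI)
qed

lemma distr_translate: "distr m m ((+) x) = m"
proof (rule measure_eqI)
  fix A assume "A \<in> sets (distr m m ((+) x))"
  then have A: "A \<in> sets borel" by simp
  have [measurable]: "(+) x \<in> measurable m m"
    by (simp cong: measurable_cong_sets)
  have "(+) x -` A = (+) (- x) ` A"
    by (auto intro: image_eqI[where x = "x + _"])
  then show "emeasure (distr m m ((+) x)) A = emeasure m A"
    using A emeasure_translate[OF A, of "- x"] by (simp add: emeasure_distr del: add_uminus_conv_diff)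
qed simp

lemma integral_translate:
  fixes f :: "'a \<Rightarrow> 'b::{banach, second_countable_topology}"
  assumes "f \<in> borel_measurable borel"
  shows "(\<integral>y. f (x + y) \<partial>m) = (\<integral>y. f y \<partial>m)"
proof -
  have "(+) x \<in> measurable m m" "f \<in> borel_measurable m"
    using assms by (simp_all cong: measurable_cong_sets)
  then have "(\<integral>y. f y \<partial>distr m m ((+) x)) = (\<integral>y. f (x + y) \<partial>m)"
    by (rule integral_distr)
  then show ?thesis by (simp add: distr_translate)
qed

lemma mult_integer_ring_eq_cball: "c \<noteq> 0 \<Longrightarrow> (*) c ` \<O>\<^sub>F = cball 0 (absval c)" for c :: 'a
proof
  show "(*) c ` \<O>\<^sub>F \<subseteq> cball 0 (absval c)"
    unfolding mem_cball_0_absval subset_eq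
    by (auto simp: integer_ring_def absval_mult mult_left_le)
next
  assume c: "c \<noteq> 0"
  show "cball (0::'a) (absval c) \<subseteq> (*) c ` \<O>\<^sub>F"
  proof
    fix x :: 'a assume "x \<in> cball 0 (absval c)"
    then have "absval (inverse c * x) \<le> 1"
      using c unfolding mem_cball_0_absval
      by (simp add: absval_divide absval_mult absval_inverse field_simps)
    then show "x \<in> (*) c ` \<O>\<^sub>F"
      using c by (intro image_eqI[of _ _ "inverse c * x"]) (auto simp: integer_ring_def field_simps)
  qed
qed

lemma residue_class_eq:
  assumes "x \<in> \<O>\<^sub>F"
  shows "{(x, y). x \<in> \<O>\<^sub>F \<and> y \<in> \<O>\<^sub>F \<and> x - y \<in> \<M>\<^sub>F} `` {x} = (+) x ` (*) \<pi> ` \<O>\<^sub>F"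
proof -
  have "(*) \<pi> ` \<O>\<^sub>F = {x. absval x < 1}"
    using \<pi> by (simp add: uniformizer_def maximal_ideal_def)
  moreover have "absval y \<le> 1" if "absval (x - y) < 1" for y
    using assms absval_diff_le[of x "x - y"] that by (simp add: integer_ring_def)
  moreover have "y \<in> (+) x ` {x. absval x < 1} \<longleftrightarrow> absval (x - y) < 1" for y
    using absval_minus_commute[of x y]
    by (auto intro!: image_eqI[of _ _ "y - x"])
  ultimately show ?thesis
    using assms by (auto simp: integer_ring_def maximal_ideal_def)
qed

lemma equiv_residue:
  "equiv \<O>\<^sub>F {(x::'a, y). x \<in> \<O>\<^sub>F \<and> y \<in> \<O>\<^sub>F \<and> x - y \<in> \<M>\<^sub>F}"
proof (rule equivI)
  show "sym {(x::'a, y). x \<in> \<O>\<^sub>F \<and> y \<in> \<O>\<^sub>F \<and> x - y \<in> \<M>\<^sub>F}"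
    by (auto simp: sym_def maximal_ideal_def absval_minus_commute)
  show "trans {(x::'a, y). x \<in> \<O>\<^sub>F \<and> y \<in> \<O>\<^sub>F \<and> x - y \<in> \<M>\<^sub>F}"
  proof (rule transI, clarsimp simp: maximal_ideal_def)
    fix x y z :: 'a assume "absval (x - y) < 1" "absval (y - z) < 1"
    then show "absval (x - z) < 1"
      using absval_ultrametric[of "x - y" "y - z"] by simp
  qed
qed (auto simp: refl_on_def maximal_ideal_def)

lemma translate_cball: "(+) x ` cball 0 r = cball x r" for x :: 'a
proof -
  have "y \<in> (+) x ` cball 0 r" if "y \<in> cball x r" for y
    using that unfolding mem_cball_absval
    by (intro image_eqI[of _ _ "y - x"]) (auto simp: mem_cball_absval simp del: mem_cball)
  moreover have "(+) x ` cball 0 r \<subseteq> cball x r"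
    by (auto simp: mem_cball_absval simp del: mem_cball)
  ultimately show ?thesis by blast
qed

text \<open>
  The ball of radius \<open>\<bar>c\<bar>\<close> is \<open>c\<close> times the ring of integers, hence the disjoint union of \<open>c\<close> times the \<open>q\<close> residue
  classes, each of which is a translate of the ball of radius \<open>\<bar>c\<bar>/q\<close>.
\<close>

lemma measure_cball_scale:
  fixes c :: 'a
  assumes c: "c \<noteq> 0"
  shows "measure m (cball 0 (absval c)) = real q * measure m (cball 0 (absval c / real q))"
proof -
  let ?F = "\<lambda>K. (*) c ` K"
  have absc: "absval (c * \<pi>) = absval c / real q"
    by (simp add: absval_mult absval_\<pi>)
  have class_meas: "?F K \<in> sets m \<and> emeasure m (?F K) = emeasure m (cball 0 (absval c / real q))"
    if K: "K \<in> residue_field" for K :: "'a set"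
  proof -
    obtain x where x: "x \<in> \<O>\<^sub>F" "K = (+) x ` (*) \<pi> ` \<O>\<^sub>F"
      using K residue_class_eq unfolding residue_field_def quotient_def by auto
    have "?F K = (+) (c * x) ` (*) (c * \<pi>) ` \<O>\<^sub>F"
      unfolding x image_image by (simp add: algebra_simps)
    also have "(*) (c * \<pi>) ` \<O>\<^sub>F = cball 0 (absval c / real q)"
      using c \<pi>_nonzero by (simp add: mult_integer_ring_eq_cball absc)
    finally have eq: "?F K = (+) (c * x) ` cball 0 (absval c / real q)" .
    have "?F K = cball (c * x) (absval c / real q)"
      unfolding eq translate_cball ..
    then have "?F K \<in> sets m" by simp
    then show ?thesis using emeasure_translate eq by simp
  qed
  have "emeasure m (cball 0 (absval c)) = emeasure m (\<Union>K\<in>residue_field. ?F K)"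
    using Union_quotient[OF equiv_residue] mult_integer_ring_eq_cball[OF c]
    by (simp add: residue_field_def flip: image_Union)
  also have "\<dots> = (\<Sum>K\<in>residue_field. emeasure m (?F K))"
  proof (rule sum_emeasure[symmetric])
    show "disjoint_family_on ?F residue_field"
      unfolding disjoint_family_on_def
    proof (intro ballI impI)
      fix K L :: "'a set" assume "K \<in> residue_field" "L \<in> residue_field" "K \<noteq> L"
      then have "K \<inter> L = {}"
        using quotient_disj[OF equiv_residue] unfolding residue_field_def by blast
      then show "?F K \<inter> ?F L = {}" using c by auto
    qed
  qed (use class_meas finite_residue_field in auto)
  also have "\<dots> = of_nat q * emeasure m (cball 0 (absval c / real q))"
    using class_meas q by (simp add: residue_card_def)
  finally show ?thesis
    by (simp add: measure_def enn2real_mult)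
qed

lemma emeasure_cball_finite: "emeasure m (cball x r) < \<infinity>"
  by (rule emeasure_compact) (simp add: compact_eq_bounded_closed)

lemma measure_cball_0_1: "measure m (cball 0 1) = 1"
proof -
  have "\<O>\<^sub>F = (cball 0 1 :: 'a set)"
    unfolding set_eq_iff mem_cball_0_absval by (simp add: integer_ring_def)
  then show ?thesis using m by (simp add: normalized_haar_measure_def measure_def)
qed

lemma measure_cball_large: "measure m (cball 0 (real q ^ n)) = real q ^ n"
proof (induction n)
  case (Suc n)
  have "absval (inverse \<pi> ^ Suc n) = real q ^ Suc n"
    by (simp only: absval_power absval_inverse absval_\<pi>) simp
  with measure_cball_scale[of "inverse \<pi> ^ Suc n"] \<pi>_nonzero q_gt_1 Suc show ?case
    by simp
qed (simp add: measure_cball_0_1)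

lemma measure_cball_0_small: "measure m (cball 0 (1 / real q ^ n)) = 1 / real q ^ n"
proof (induction n)
  case (Suc n)
  have "absval (\<pi> ^ n) = 1 / real q ^ n"
    by (simp add: absval_power absval_\<pi> power_one_over)
  with measure_cball_scale[of "\<pi> ^ n"] \<pi>_nonzero q_gt_1 Suc show ?case
    by (simp add: field_simps)
qed (simp add: measure_cball_0_1)

lemma measure_cball_small: "measure m (cball x (1 / real q ^ n)) = 1 / real q ^ n"
proof -
  have "cball x (1 / real q ^ n) = (+) x ` cball 0 (1 / real q ^ n)"
    unfolding translate_cball ..
  then have "measure m (cball x (1 / real q ^ n)) = measure m (cball 0 (1 / real q ^ n))"
    using emeasure_translate[of "cball 0 (1 / real q ^ n)" x] by (simp add: measure_def)
  then show ?thesis by (simp add: measure_cball_0_small)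
qed

sublocale sigma_finite_measure m
proof
  have "(\<Union>n::nat. cball 0 (real n)) = (UNIV :: 'a set)"
    using real_arch_simple by fastforce
  then show "\<exists>A. countable A \<and> A \<subseteq> sets m \<and> \<Union>A = space m \<and> (\<forall>a\<in>A. emeasure m a \<noteq> \<infinity>)"
    using emeasure_cball_finite
    by (intro exI[of _ "range (\<lambda>n::nat. cball 0 (real n))"]) (auto simp: less_top)
qed

sublocale pair: pair_sigma_finite m m ..

lemma measurable_character [measurable]: "\<psi> \<in> borel_measurable borel"
  using \<psi> by (auto simp: additive_character_def intro: borel_measurable_continuous_onI)

lemma measurable_mult_field [measurable (raw)]:
  assumes [measurable]: "f \<in> borel_measurable N" "g \<in> borel_measurable N"
  shows "(\<lambda>x. f x * g x :: 'a) \<in> borel_measurable N"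
  by (rule borel_measurable_continuous_Pair[OF assms]) (intro continuous_on_mult_absval continuous_intros)

lemma measurable_diff_field [measurable (raw)]:
  assumes [measurable]: "f \<in> borel_measurable N" "g \<in> borel_measurable N"
  shows "(\<lambda>x. f x - g x :: 'a) \<in> borel_measurable N"
  by (rule borel_measurable_continuous_Pair[OF assms]) (intro continuous_on_diff_absval continuous_intros)

lemma character_add: "\<psi> (x + y) = \<psi> x * \<psi> y"
  using \<psi> by (auto simp: additive_character_def)

lemma norm_character [simp]: "cmod (\<psi> x) = 1"
  using \<psi> by (auto simp: additive_character_def)

lemma character_0 [simp]: "\<psi> 0 = 1"
  using \<psi>_trivial by (auto simp: integer_ring_def)

lemma character_minus: "\<psi> (- x) = cnj (\<psi> x)"
proof -
  have "\<psi> (- x) * \<psi> x = 1" by (simp flip: character_add)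
  moreover have "cnj (\<psi> x) * \<psi> x = 1" by (metis complex_norm_square mult.commute norm_character of_real_1 power_one)
  moreover have "\<psi> x \<noteq> 0" by (metis norm_character norm_zero zero_neq_one)
  ultimately show ?thesis by (metis mult_right_cancel)
qed

lemma character_diff: "\<psi> (x - y) = \<psi> x * cnj (\<psi> y)"
  using character_add[of x "- y"] by (simp add: character_minus)

text \<open>
  If \<open>\<bar>z\<bar> \<le> q\<^bsup>-n\<^esup>\<close>, then \<open>z y\<close> is an integer throughout the ball and the character is \<open>1\<close>. Otherwise \<open>z\<close> times the ball
  contains \<open>\<pi>\<^bsup>-1\<^esup> \<O>\<^sub>F\<close>, so it contains some \<open>w = z u\<close> with \<open>\<psi> w \<noteq> 1\<close>; translating by \<open>u\<close> multiplies the integral by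
  \<open>\<psi> w\<close>, which forces it to vanish.
\<close>

lemma integral_character_cball:
  "(\<integral>y. indicator (cball 0 (real q ^ n)) y * \<psi> (z * y) \<partial>m) =
     (if absval z \<le> 1 / real q ^ n then of_real (real q ^ n) else 0)"
proof (cases "absval z \<le> 1 / real q ^ n")
  case True
  have "\<psi> (z * y) = 1" if "y \<in> cball 0 (real q ^ n)" for y
  proof -
    have "absval (z * y) \<le> 1 / real q ^ n * real q ^ n"
      unfolding absval_mult using that True mem_cball_0_absval by (intro mult_mono) auto
    then show ?thesis
      using \<psi>_trivial q_gt_1 by (simp add: integer_ring_def)
  qed
  then have "(\<integral>y. indicator (cball 0 (real q ^ n)) y * \<psi> (z * y) \<partial>m) =
      (\<integral>y. of_real (indicator (cball 0 (real q ^ n)) y) \<partial>m)"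
    by (intro Bochner_Integration.integral_cong) (auto simp: indicator_def)
  also have "\<dots> = of_real (real q ^ n)"
    by (simp only: integral_complex_of_real) (simp add: measure_cball_large)
  finally show ?thesis using True by simp
next
  case False
  then have z: "z \<noteq> 0" by auto
  define B where "B = cball (0::'a) (real q ^ n)"
  obtain w where w: "absval w \<le> real q" "\<psi> w \<noteq> 1"
  proof -
    have "\<exists>x\<in>\<O>\<^sub>F. \<psi> (inverse \<pi> * x) \<noteq> 1"
      using \<psi>_nontrivial by (auto simp: constant_on_def)
    then obtain x where x: "absval x \<le> 1" "\<psi> (inverse \<pi> * x) \<noteq> 1"
      by (auto simp: integer_ring_def)
    then show ?thesis
      by (intro that[of "inverse \<pi> * x"])
        (auto simp: absval_mult absval_inverse absval_\<pi> mult_left_le)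
  qed
  \<comment> \<open>Since \<open>\<bar>\<pi>\<^sup>n / z\<bar> < 1\<close> is at most \<open>1/q\<close>, the gap in the values makes up for the factor \<open>\<bar>w\<bar> \<le> q\<close>.\<close>
  define u where "u = inverse z * w"
  have "absval (\<pi> ^ n * inverse z) < 1"
    using False z q_gt_1 by (simp add: absval_mult absval_divide absval_power absval_inverse absval_\<pi> field_simps)
  from absval_less_1_imp_le[OF this] have "inverse (absval z) \<le> real q ^ n / real q"
    using z q_gt_1 by (simp add: absval_mult absval_divide absval_power absval_inverse absval_\<pi> field_simps)
  then have "inverse (absval z) * absval w \<le> real q ^ n / real q * real q"
    using w by (intro mult_mono) auto
  then have u: "u \<in> B"
    using q_gt_1 unfolding B_def mem_cball_0_absval u_def by (simp add: absval_mult absval_inverse)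
  have zu: "z * u = w"
    using z by (simp add: u_def)
  have [measurable]: "B \<in> sets borel" by (simp add: B_def)
  have "(\<integral>y. indicator B y * \<psi> (z * y) \<partial>m) = (\<integral>y. indicator B (u + y) * \<psi> (z * (u + y)) \<partial>m)"
    by (rule integral_translate[symmetric]) measurable
  also have "\<dots> = (\<integral>y. \<psi> w * (indicator B y * \<psi> (z * y)) \<partial>m)"
    using cball_0_add_iff[OF u[unfolded B_def], folded B_def]
    by (intro Bochner_Integration.integral_cong) (auto simp: indicator_def distrib_left character_add zu)
  also have "\<dots> = \<psi> w * (\<integral>y. indicator B y * \<psi> (z * y) \<partial>m)"
    by simp
  finally have "(\<integral>y. indicator B y * \<psi> (z * y) \<partial>m) = 0"
    using w by simp
  then show ?thesis using False by (simp add: B_def)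
qed

end

section \<open>Plancherel's theorem for the indicator of a set\<close>

context local_field_fourier
begin

lemma measurable_cnj [measurable (raw)]:
  assumes "f \<in> borel_measurable N"
  shows "(\<lambda>x. cnj (f x)) \<in> borel_measurable N"
  by (rule borel_measurable_continuous_on[OF _ assms]) (intro continuous_intros)

lemma sets_cball [measurable]: "cball (x::'a) r \<in> sets borel"
  by simp

lemma ball_indicator_measurable [measurable (raw)]:
  assumes "f \<in> borel_measurable N"
  shows "Measurable.pred N (\<lambda>x. absval (f x :: 'a) \<le> r)"
proof -
  have "Measurable.pred N (\<lambda>x. f x \<in> cball 0 r)"
    using assms by measurable
  then show ?thesis unfolding mem_cball_0_absval .
qed

lemma integrable_pair_bounded:
  fixes f :: "'a \<Rightarrow> 'a \<Rightarrow> 'b::{banach, second_countable_topology}"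
  assumes [measurable]: "case_prod f \<in> borel_measurable (m \<Otimes>\<^sub>M m)" "A \<in> sets borel" "B \<in> sets borel"
    and fin: "emeasure m A < \<infinity>" "emeasure m B < \<infinity>"
    and bound: "\<And>x y. norm (f x y) \<le> C"
    and supp: "\<And>x y. \<not> (x \<in> A \<and> y \<in> B) \<Longrightarrow> f x y = 0"
  shows "integrable (m \<Otimes>\<^sub>M m) (case_prod f)"
proof (rule integrableI_bounded_set[where A = "A \<times> B" and B = C])
  show "emeasure (m \<Otimes>\<^sub>M m) (A \<times> B) < \<infinity>"
    using fin by (simp add: emeasure_pair_measure_Times ennreal_mult_less_top)
  show "A \<times> B \<in> sets (m \<Otimes>\<^sub>M m)"
    by (intro pair_measureI) simp_all
  show "AE z in m \<Otimes>\<^sub>M m. z \<notin> A \<times> B \<longrightarrow> case_prod f z = 0"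
    using supp by (intro AE_I2) (force split: prod.split)
qed (use bound in auto)

text \<open>
  The normalized indicator of the ball of radius \<open>q\<^bsup>-n\<^esup>\<close>: an approximate identity, and by
  \<open>integral_character_cball\<close> the Fourier transform of the indicator of the ball of radius \<open>q\<^sup>n\<close>.
\<close>

definition ball_kernel :: "nat \<Rightarrow> 'a \<Rightarrow> real" where
  "ball_kernel n z = (if absval z \<le> 1 / real q ^ n then real q ^ n else 0)"

lemma measurable_ball_kernel [measurable]: "ball_kernel n \<in> borel_measurable borel"
  unfolding ball_kernel_def[abs_def] by measurable

lemma ball_kernel_nonneg [simp]: "0 \<le> ball_kernel n z"
  by (simp add: ball_kernel_def)

lemma ball_kernel_le: "ball_kernel n z \<le> real q ^ n"
  by (simp add: ball_kernel_def)

lemma ball_kernel_eq_indicator: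
  "ball_kernel n (x - y) = real q ^ n * indicator (cball x (1 / real q ^ n)) y"
  "ball_kernel n (x - y) = real q ^ n * indicator (cball y (1 / real q ^ n)) x"
  by (simp_all add: ball_kernel_def indicator_def dist_absval absval_minus_commute)

lemma integrable_ball_kernel: "integrable m (\<lambda>y. ball_kernel n (x - y))"
  unfolding ball_kernel_eq_indicator(1) using emeasure_cball_finite by (simp add: less_top)

lemma integral_ball_kernel:
  "(\<integral>y. ball_kernel n (x - y) \<partial>m) = 1"
  "(\<integral>x. ball_kernel n (x - y) \<partial>m) = 1"
proof -
  show "(\<integral>y. ball_kernel n (x - y) \<partial>m) = 1"
    unfolding ball_kernel_eq_indicator(1) using q_gt_1 by (simp add: measure_cball_small)
  show "(\<integral>x. ball_kernel n (x - y) \<partial>m) = 1"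
    unfolding ball_kernel_eq_indicator(2) using q_gt_1 by (simp add: measure_cball_small)
qed

text \<open>
  The proportion of the ball of radius \<open>q\<^bsup>-n\<^esup>\<close> about \<open>x\<close> that lies in \<open>A\<close>.
\<close>

definition local_density :: "nat \<Rightarrow> 'a set \<Rightarrow> 'a \<Rightarrow> real" where
  "local_density n A x = (\<integral>y. indicator A y * ball_kernel n (x - y) \<partial>m)"

lemma measurable_local_density [measurable]:
  assumes [measurable]: "A \<in> sets borel"
  shows "local_density n A \<in> borel_measurable borel"
  unfolding local_density_def[abs_def] by measurable

lemma integrable_local_density_integrand:
  assumes [measurable]: "A \<in> sets borel"
  shows "integrable m (\<lambda>y. indicator A y * ball_kernel n (x - y))"
  using integrable_mult_indicator[OF _ integrable_ball_kernel, of A] by simp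

lemma local_density_nonneg: "0 \<le> local_density n A x"
  unfolding local_density_def by (intro integral_nonneg_AE) simp

lemma local_density_mono:
  assumes "A \<in> sets borel" "B \<in> sets borel" "A \<subseteq> B"
  shows "local_density n A x \<le> local_density n B x"
  unfolding local_density_def using assms
  by (intro integral_mono integrable_local_density_integrand) (auto simp: indicator_def)

lemma local_density_le_1:
  assumes "A \<in> sets borel"
  shows "local_density n A x \<le> 1"
  using local_density_mono[OF assms, of UNIV n x] integral_ball_kernel(1)[of n x]
  by (simp add: local_density_def)

lemma local_density_eq_0:
  assumes "cball x (1 / real q ^ n) \<inter> A = {}"
  shows "local_density n A x = 0"
proof -
  have zero: "indicator A y * ball_kernel n (x - y) = 0" for y
    using assms by (auto simp: ball_kernel_eq_indicator(1) indicator_def)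
  show ?thesis unfolding local_density_def zero by simp
qed

lemma integrable_indicator_local_density:
  assumes [measurable]: "A \<in> sets borel" "B \<in> sets borel" and "emeasure m A < \<infinity>"
  shows "integrable m (\<lambda>x. indicator A x * local_density n B x)"
  by (rule integrableI_bounded_set[where A = A and B = 1])
    (use assms local_density_nonneg local_density_le_1 in \<open>auto simp: indicator_def\<close>)

text \<open>
  By Fubini's theorem the local density of \<open>K\<close> has total integral \<open>m(K)\<close>. At each point outside the closed set
  \<open>K\<close> it is eventually \<open>0\<close>, and for all \<open>n\<close> it vanishes outside a fixed ball around \<open>K\<close>; by dominated convergence the
  mass outside \<open>K\<close> disappears.
\<close>

lemma tendsto_integral_local_density_compact:
  assumes K: "compact K"
  shows "(\<lambda>n. \<integral>x. indicator K x * local_density n K x \<partial>m) \<longlonglongrightarrow> measure m K"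
proof -
  have [measurable]: "K \<in> sets borel" using K by (simp add: borel_compact)
  obtain R where R: "K \<subseteq> cball 0 R"
    using K compact_imp_bounded bounded_subset_cball by (metis bounded_any_center subset_eq mem_cball)
  define D where "D = cball (0::'a) (R + 1)"
  have [measurable]: "D \<in> sets borel" by (simp add: D_def)
  have Dfin: "emeasure m D < \<infinity>" by (simp add: D_def emeasure_cball_finite[unfolded infinity_ennreal_def])
  have Kfin: "emeasure m K < \<infinity>" using K by (rule emeasure_compact)
  have outside: "ball_kernel n (x - y) = 0" if "x \<notin> D" "y \<in> K" for n x y
  proof -
    have "1 / real q ^ n \<le> 1" using q_gt_1 by simp
    moreover have "dist 0 y \<le> R" using R that by auto
    ultimately show ?thesis
      using that dist_triangle[of 0 x y] by (simp add: D_def ball_kernel_def dist_absval[symmetric] dist_commute)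
  qed
  have outside_density: "local_density n K x = 0" if "x \<notin> D" for n x
  proof -
    have zero: "indicator K y * ball_kernel n (x - y) = 0" for y
      using outside[OF that, of y n] by (simp add: indicator_def)
    show ?thesis unfolding local_density_def zero by simp
  qed
  have total: "(\<integral>x. local_density n K x \<partial>m) = measure m K" for n
  proof -
    have "(\<integral>x. local_density n K x \<partial>m) = (\<integral>y. \<integral>x. indicator K y * ball_kernel n (x - y) \<partial>m \<partial>m)"
      unfolding local_density_def
    proof (rule pair.Fubini_integral[symmetric], rule integrable_pair_bounded[where A = D and B = K and C = "real q ^ n"])
      fix x y show "norm (indicator K y * ball_kernel n (x - y)) \<le> real q ^ n"
        by (simp add: ball_kernel_le indicator_def)
      show "(\<lambda>(x, y). indicator K y * ball_kernel n (x - y)) \<in> borel_measurable (m \<Otimes>\<^sub>M m)"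
        by measurable
    qed (use outside Dfin Kfin in \<open>auto simp: indicator_def\<close>)
    also have "\<dots> = (\<integral>y. indicator K y \<partial>m)"
      by (simp add: integral_ball_kernel)
    finally show ?thesis by simp
  qed
  have "(\<lambda>n. \<integral>x. indicator (- K) x * local_density n K x \<partial>m) \<longlonglongrightarrow> (\<integral>x. 0 \<partial>m)"
  proof (rule integral_dominated_convergence[where w = "indicator D"])
    show "integrable m (indicator D :: 'a \<Rightarrow> real)" using Dfin by simp
    show "AE x in m. (\<lambda>n. indicator (- K) x * local_density n K x) \<longlonglongrightarrow> 0"
    proof (rule AE_I2)
      fix x
      show "(\<lambda>n. indicator (- K) x * local_density n K x) \<longlonglongrightarrow> 0"
      proof (cases "x \<in> K")
        case False
        then obtain e where e: "e > 0" "cball x e \<subseteq> - K"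
          using compact_imp_closed[OF K] open_contains_cball[of "- K"] by auto
        have "(\<lambda>n. 1 / real q ^ n) \<longlonglongrightarrow> 0"
          using q_gt_1 LIMSEQ_inverse_realpow_zero[of "real q"] by (simp add: inverse_eq_divide)
        then have "eventually (\<lambda>n. 1 / real q ^ n < e) sequentially"
          using e by (simp add: order_tendstoD)
        then have "eventually (\<lambda>n. indicator (- K) x * local_density n K x = 0) sequentially"
        proof eventually_elim
          case (elim n)
          then have "cball x (1 / real q ^ n) \<inter> K = {}" using e by force
          then show ?case by (simp add: local_density_eq_0)
        qed
        then show ?thesis by (rule tendsto_eventually)
      qed simp
    qed
    fix n show "AE x in m. norm (indicator (- K) x * local_density n K x) \<le> indicator D x"
    proof (rule AE_I2)
      fix x
      have "local_density n K x = 0" if "x \<notin> D"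
        using that by (rule outside_density)
      then show "norm (indicator (- K) x * local_density n K x) \<le> indicator D x"
        using local_density_nonneg[of n K x] local_density_le_1[of K n x]
        by (auto simp: indicator_def)
    qed
  qed measurable
  moreover have "(\<integral>x. indicator K x * local_density n K x \<partial>m)
      = measure m K - (\<integral>x. indicator (- K) x * local_density n K x \<partial>m)" for n
  proof -
    have int: "integrable m (local_density n K)"
    proof (rule integrableI_bounded_set[where A = D and B = 1])
      show "AE x in m. x \<notin> D \<longrightarrow> local_density n K x = 0"
        using outside_density by (intro AE_I2) simp
    qed (use Dfin local_density_nonneg local_density_le_1 in auto)
    have "(\<integral>x. indicator K x * local_density n K x \<partial>m) + (\<integral>x. indicator (- K) x * local_density n K x \<partial>m)
      = (\<integral>x. indicator K x * local_density n K x + indicator (- K) x * local_density n K x \<partial>m)"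
      using integrable_mult_indicator[OF _ int, of K] integrable_mult_indicator[OF _ int, of "- K"]
      by (intro Bochner_Integration.integral_add[symmetric]) simp_all
    also have "\<dots> = (\<integral>x. local_density n K x \<partial>m)"
      by (intro Bochner_Integration.integral_cong) (auto simp: indicator_def)
    finally show ?thesis using total[of n] by simp
  qed
  ultimately show ?thesis
    by (simp add: tendsto_diff[OF tendsto_const, of _ 0, simplified])
qed

text \<open>
  The integral is at most \<open>m(S)\<close>, as densities are at most \<open>1\<close>, and it is monotone in the set. So it suffices to
  bound it below through a compact \<open>K \<subseteq> S\<close> with almost the same measure. This takes the place of the Lebesgue
  density theorem.
\<close>

lemma tendsto_integral_local_density:
  assumes S [measurable]: "S \<in> sets borel" and fin: "emeasure m S < \<infinity>"
  shows "(\<lambda>n. \<integral>x. indicator S x * local_density n S x \<partial>m) \<longlonglongrightarrow> measure m S"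
proof (rule LIMSEQ_I)
  fix e :: real assume e: "e > 0"
  \<comment> \<open>The restriction of \<open>m\<close> to \<open>S\<close> is a finite measure, hence inner regular.\<close>
  define \<mu> where "\<mu> = density m (indicator S)"
  have em\<mu>: "emeasure \<mu> A = emeasure m (A \<inter> S)" if "A \<in> sets borel" for A
    using that by (simp add: \<mu>_def emeasure_density Int_commute flip: indicator_inter_arith)
  have "emeasure \<mu> S = (SUP K \<in> {K. K \<subseteq> S \<and> compact K}. emeasure \<mu> K)"
    using fin em\<mu>[of UNIV] by (intro inner_regular) (auto simp: \<mu>_def)
  then have sup: "emeasure m S = (SUP K \<in> {K. K \<subseteq> S \<and> compact K}. emeasure \<mu> K)"
    using em\<mu>[of S] by simp
  obtain K where K: "K \<subseteq> S" "compact K" "measure m S < measure m K + e"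
  proof (cases "measure m S = 0")
    case True
    then show ?thesis using e by (intro that[of "{}"]) auto
  next
    case False
    have "ennreal (measure m S - e) < ennreal (measure m S)"
      using e False by (intro ennreal_lessI) (auto simp: less_le)
    also have "\<dots> = emeasure m S"
      using fin by (intro emeasure_eq_ennreal_measure[symmetric]) auto
    finally obtain K where K: "K \<subseteq> S" "compact K" "ennreal (measure m S - e) < emeasure \<mu> K"
      unfolding sup less_SUP_iff by auto
    have "emeasure \<mu> K = ennreal (measure m K)"
      using K em\<mu>[of K] emeasure_compact[OF K(2)]
      by (simp add: borel_compact Int_absorb2 emeasure_eq_ennreal_measure less_top)
    then have "measure m S - e < measure m K"
      using K(3) by (metis ennreal_leI not_le)
    then show ?thesis using K by (intro that[of K]) auto
  qed
  have [measurable]: "K \<in> sets borel" using K by (simp add: borel_compact)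
  have "eventually (\<lambda>n. (\<integral>x. indicator K x * local_density n K x \<partial>m) > measure m S - e) sequentially"
    using K by (intro order_tendstoD(1)[OF tendsto_integral_local_density_compact]) auto
  then obtain N where N: "\<And>n. n \<ge> N \<Longrightarrow> (\<integral>x. indicator K x * local_density n K x \<partial>m) > measure m S - e"
    by (auto simp: eventually_sequentially)
  have lower: "(\<integral>x. indicator K x * local_density n K x \<partial>m) \<le> (\<integral>x. indicator S x * local_density n S x \<partial>m)" for n
    using K fin emeasure_compact[OF K(2)] local_density_mono[of K S n] local_density_nonneg[of n S]
    by (intro integral_mono integrable_indicator_local_density) (auto simp: indicator_def)
  have upper: "(\<integral>x. indicator S x * local_density n S x \<partial>m) \<le> measure m S" for n
  proof -
    have "integrable m (indicator S :: 'a \<Rightarrow> real)" using fin by simp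
    then have "(\<integral>x. indicator S x * local_density n S x \<partial>m) \<le> (\<integral>x. indicator S x \<partial>m)"
      by (intro integral_mono integrable_indicator_local_density)
        (use S fin local_density_le_1[OF S, of n] in \<open>auto split: split_indicator\<close>)
    then show ?thesis by simp
  qed
  show "\<exists>no. \<forall>n\<ge>no. norm ((\<integral>x. indicator S x * local_density n S x \<partial>m) - measure m S) < e"
  proof (intro exI allI impI)
    fix n assume "N \<le> n"
    then show "norm ((\<integral>x. indicator S x * local_density n S x \<partial>m) - measure m S) < e"
      using N[of n] lower[of n] upper[of n] e unfolding real_norm_def by linarith
  qed
qed

end

locale fourier_of_set = local_field_fourier m \<pi> \<psi> q
  for m :: "'a::nonarch_local_field measure" and \<pi> \<psi> q +
  fixes S :: "'a set"
  assumes S_sets [measurable]: "S \<in> sets borel" and S_finite: "emeasure m S < \<infinity>"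
begin

definition fhat :: "'a \<Rightarrow> complex" where
  "fhat = fourier m \<psi> (indicator S)"

lemma fhat_eq: "fhat y = (\<integral>x. indicator S x * \<psi> (x * y) \<partial>m)"
  by (simp add: fhat_def fourier_def)

lemma measurable_fhat [measurable]: "fhat \<in> borel_measurable borel"
  unfolding fhat_eq[abs_def] by measurable

lemma cnj_fhat: "cnj (fhat y) = (\<integral>x. indicator S x * \<psi> (- (x * y)) \<partial>m)"
proof -
  have "cnj (fhat y) = (\<integral>x. cnj (indicator S x * \<psi> (x * y)) \<partial>m)"
    unfolding fhat_eq by (rule Bochner_Integration.integral_cnj[symmetric])
  also have "\<dots> = (\<integral>x. indicator S x * \<psi> (- (x * y)) \<partial>m)"
    by (intro Bochner_Integration.integral_cong) (auto simp: indicator_def character_minus)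
  finally show ?thesis .
qed

lemma fhat_minus: "fhat (- y) = cnj (fhat y)"
  unfolding cnj_fhat by (simp add: fhat_eq)

lemma fhat_0: "fhat 0 = of_real (measure m S)"
proof -
  have "fhat 0 = (\<integral>x. of_real (indicator S x) \<partial>m)"
    unfolding fhat_eq by (intro Bochner_Integration.integral_cong) (auto simp: indicator_def)
  then show ?thesis by (simp only: integral_complex_of_real) simp
qed

lemma norm_fhat_le: "cmod (fhat y) \<le> measure m S"
proof -
  have "cmod (fhat y) \<le> (\<integral>x. cmod (indicator S x * \<psi> (x * y)) \<partial>m)"
    unfolding fhat_eq by (rule integral_norm_bound)
  also have "\<dots> = (\<integral>x. indicator S x \<partial>m)"
    by (intro Bochner_Integration.integral_cong) (auto simp: indicator_def norm_mult)
  finally show ?thesis by simp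
qed

text \<open>
  Expanding \<open>\<bar>f\<bar>\<^sup>2\<close> as a double integral over \<open>S \<times> S\<close> and integrating \<open>\<psi>((x - x') y)\<close> over \<open>y\<close> in the ball first leaves
  exactly the kernel \<open>ball_kernel n (x - x')\<close>. The expansion is done in two steps, one for each factor, so that
  only Fubini's theorem for two variables is used.
\<close>

lemma integral_cball_norm_fhat_sq:
  "(\<integral>y. indicator (cball 0 (real q ^ n)) y * (cmod (fhat y))\<^sup>2 \<partial>m) =
     (\<integral>x. indicator S x * local_density n S x \<partial>m)"
proof -
  define B where "B = cball (0::'a) (real q ^ n)"
  have [measurable]: "B \<in> sets borel" by (simp add: B_def)
  have Bfin: "emeasure m B < \<infinity>" by (simp add: B_def emeasure_cball_finite[unfolded infinity_ennreal_def])
  let ?I = "\<lambda>A x. indicator A x :: complex"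
  have inner: "(\<integral>y. ?I B y * \<psi> (x * y) * cnj (fhat y) \<partial>m) = of_real (local_density n S x)" for x
  proof -
    have "(\<integral>y. ?I B y * \<psi> (x * y) * cnj (fhat y) \<partial>m)
        = (\<integral>y. (\<integral>x'. ?I S x' * (?I B y * \<psi> ((x - x') * y)) \<partial>m) \<partial>m)"
    proof (rule Bochner_Integration.integral_cong[OF refl])
      fix y
      have "?I B y * \<psi> (x * y) * cnj (fhat y)
          = (\<integral>x'. ?I B y * \<psi> (x * y) * (?I S x' * \<psi> (- (x' * y))) \<partial>m)"
        unfolding cnj_fhat by simp
      also have "\<dots> = (\<integral>x'. ?I S x' * (?I B y * \<psi> ((x - x') * y)) \<partial>m)"
        by (intro Bochner_Integration.integral_cong)
          (auto simp: left_diff_distrib character_diff character_minus)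
      finally show "?I B y * \<psi> (x * y) * cnj (fhat y)
          = (\<integral>x'. ?I S x' * (?I B y * \<psi> ((x - x') * y)) \<partial>m)" .
    qed
    also have "\<dots> = (\<integral>x'. (\<integral>y. ?I S x' * (?I B y * \<psi> ((x - x') * y)) \<partial>m) \<partial>m)"
    proof (rule pair.Fubini_integral, rule integrable_pair_bounded[where A = S and B = B and C = 1])
      show "(\<lambda>(x', y). ?I S x' * (?I B y * \<psi> ((x - x') * y))) \<in> borel_measurable (m \<Otimes>\<^sub>M m)"
        by measurable
    qed (use S_finite Bfin in \<open>auto simp: indicator_def norm_mult\<close>)
    also have "\<dots> = (\<integral>x'. of_real (indicator S x' * ball_kernel n (x - x')) \<partial>m)"
      unfolding B_def integral_mult_right_zero integral_character_cball
      by (intro Bochner_Integration.integral_cong) (auto simp: indicator_def ball_kernel_def)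
    also have "\<dots> = of_real (local_density n S x)"
      unfolding local_density_def by (rule integral_complex_of_real)
    finally show ?thesis .
  qed
  have "complex_of_real (\<integral>y. indicator B y * (cmod (fhat y))\<^sup>2 \<partial>m)
      = (\<integral>y. of_real (indicator B y * (cmod (fhat y))\<^sup>2) \<partial>m)"
    by (rule integral_complex_of_real[symmetric])
  also have "\<dots> = (\<integral>y. (\<integral>x. ?I S x * (?I B y * \<psi> (x * y) * cnj (fhat y)) \<partial>m) \<partial>m)"
  proof (rule Bochner_Integration.integral_cong[OF refl])
    fix y
    have "of_real (indicator B y * (cmod (fhat y))\<^sup>2) = ?I B y * cnj (fhat y) * fhat y"
      by (auto simp: indicator_def complex_norm_square mult.commute simp flip: of_real_power)
    also have "\<dots> = (\<integral>x. ?I B y * cnj (fhat y) * (?I S x * \<psi> (x * y)) \<partial>m)"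
      by (simp add: fhat_eq[symmetric])
    also have "\<dots> = (\<integral>x. ?I S x * (?I B y * \<psi> (x * y) * cnj (fhat y)) \<partial>m)"
      by (intro Bochner_Integration.integral_cong) auto
    finally show "of_real (indicator B y * (cmod (fhat y))\<^sup>2) =
      (\<integral>x. ?I S x * (?I B y * \<psi> (x * y) * cnj (fhat y)) \<partial>m)" .
  qed
  also have "\<dots> = (\<integral>x. (\<integral>y. ?I S x * (?I B y * \<psi> (x * y) * cnj (fhat y)) \<partial>m) \<partial>m)"
  proof (rule pair.Fubini_integral,
        rule integrable_pair_bounded[where A = S and B = B and C = "measure m S"])
    show "(\<lambda>(x, y). ?I S x * (?I B y * \<psi> (x * y) * cnj (fhat y))) \<in> borel_measurable (m \<Otimes>\<^sub>M m)"
      by measurable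
  qed (use S_finite Bfin norm_fhat_le in \<open>auto simp: indicator_def norm_mult\<close>)
  also have "\<dots> = (\<integral>x. of_real (indicator S x * local_density n S x) \<partial>m)"
    unfolding integral_mult_right_zero inner
    by (intro Bochner_Integration.integral_cong) (auto simp: indicator_def)
  also have "\<dots> = of_real (\<integral>x. indicator S x * local_density n S x \<partial>m)"
    by (rule integral_complex_of_real)
  finally show ?thesis unfolding of_real_eq_iff B_def .
qed

lemma integrable_cball_norm_fhat_sq:
  "integrable m (\<lambda>y. indicator (cball 0 (real q ^ n)) y * (cmod (fhat y))\<^sup>2)"
  using emeasure_cball_finite norm_fhat_le
  by (intro integrableI_bounded_set[where A = "cball 0 (real q ^ n)" and B = "(measure m S)\<^sup>2"])
    (auto simp: power_mono indicator_def)

text \<open>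
  The squared transform is the increasing limit of its restrictions to balls, whose integrals tend to \<open>m(S)\<close>.
\<close>

lemma plancherel:
  shows integrable_norm_fhat_sq: "integrable m (\<lambda>y. (cmod (fhat y))\<^sup>2)"
    and integral_norm_fhat_sq: "(\<integral>y. (cmod (fhat y))\<^sup>2 \<partial>m) = measure m S"
proof -
  let ?f = "\<lambda>n y. indicator (cball 0 (real q ^ n)) y * (cmod (fhat y))\<^sup>2"
  have mono: "AE y in m. mono (\<lambda>n. ?f n y)"
  proof (intro AE_I2 monoI)
    fix y and i j :: nat assume "i \<le> j"
    then have "real q ^ i \<le> real q ^ j" using q_gt_1 by (intro power_increasing) auto
    then show "?f i y \<le> ?f j y" by (auto simp: indicator_def)
  qed
  have lim: "AE y in m. (\<lambda>n. ?f n y) \<longlonglongrightarrow> (cmod (fhat y))\<^sup>2"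
  proof (intro AE_I2 tendsto_eventually)
    fix y :: 'a
    obtain N where N: "dist 0 y < real q ^ N"
      using real_arch_pow[of "real q"] q_gt_1 by auto
    show "eventually (\<lambda>n. ?f n y = (cmod (fhat y))\<^sup>2) sequentially"
      using eventually_ge_at_top[of N]
    proof eventually_elim
      case (elim n)
      then have "real q ^ N \<le> real q ^ n" using q_gt_1 by (intro power_increasing) auto
      then show ?case using N by (simp add: indicator_def)
    qed
  qed
  have ilim: "(\<lambda>n. integral\<^sup>L m (?f n)) \<longlonglongrightarrow> measure m S"
    unfolding integral_cball_norm_fhat_sq
    by (rule tendsto_integral_local_density[OF S_sets S_finite])
  have meas: "(\<lambda>y. (cmod (fhat y))\<^sup>2) \<in> borel_measurable m" by measurable
  show "integrable m (\<lambda>y. (cmod (fhat y))\<^sup>2)"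
    by (rule integral_monotone_convergence_nonneg(1)[OF integrable_cball_norm_fhat_sq mono _ lim ilim meas]) simp
  show "(\<integral>y. (cmod (fhat y))\<^sup>2 \<partial>m) = measure m S"
    by (rule integral_monotone_convergence_nonneg(2)[OF integrable_cball_norm_fhat_sq mono _ lim ilim meas]) simp
qed

definition fourier_tail :: "nat \<Rightarrow> real" where
  "fourier_tail n = (LINT y:(UNIV - cball 0 (real q ^ n))|m. (cmod (fhat y))\<^sup>2)"

lemma integral_cball_eq_tail:
  "(\<integral>y. indicator (cball 0 (real q ^ n)) y * (cmod (fhat y))\<^sup>2 \<partial>m) = measure m S - fourier_tail n"
proof -
  let ?B = "cball (0::'a) (real q ^ n)"
  have "(\<integral>y. indicator ?B y * (cmod (fhat y))\<^sup>2 \<partial>m) + fourier_tail n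
      = (\<integral>y. indicator ?B y * (cmod (fhat y))\<^sup>2 + indicator (UNIV - ?B) y * (cmod (fhat y))\<^sup>2 \<partial>m)"
    unfolding fourier_tail_def set_lebesgue_integral_def real_scaleR_def
    using integrable_mult_indicator[OF _ integrable_norm_fhat_sq, of "UNIV - ?B"]
    by (intro Bochner_Integration.integral_add[symmetric] integrable_cball_norm_fhat_sq) simp_all
  also have "\<dots> = (\<integral>y. (cmod (fhat y))\<^sup>2 \<partial>m)"
    by (intro Bochner_Integration.integral_cong) (auto simp: indicator_def)
  finally show ?thesis by (simp add: integral_norm_fhat_sq)
qed

text \<open>
  For \<open>x\<close> in the ball, the translation by \<open>x\<close> preserves the ball, and \<open>\<bar>f(-y)\<bar> = \<bar>f(y)\<bar>\<close>.
\<close>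

lemma integral_cball_translate:
  assumes "x \<in> cball 0 (real q ^ n)"
  shows "(\<integral>y. indicator (cball 0 (real q ^ n)) y * (cmod (fhat (x - y)))\<^sup>2 \<partial>m)
    = measure m S - fourier_tail n"
proof -
  have "(\<integral>y. indicator (cball 0 (real q ^ n)) y * (cmod (fhat (x - y)))\<^sup>2 \<partial>m)
      = (\<integral>y. indicator (cball 0 (real q ^ n)) (x + y) * (cmod (fhat (x - (x + y))))\<^sup>2 \<partial>m)"
    by (rule integral_translate[symmetric]) measurable
  also have "\<dots> = (\<integral>y. indicator (cball 0 (real q ^ n)) y * (cmod (fhat y))\<^sup>2 \<partial>m)"
    using cball_0_add_iff[OF assms]
    by (intro Bochner_Integration.integral_cong) (simp_all add: indicator_def fhat_minus del: mem_cball)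
  finally show ?thesis by (simp add: integral_cball_eq_tail)
qed

end

section \<open>Averages of weakly correlated random variables\<close>

text \<open>
  Adding the variable \<open>Y\<^sub>N\<close> to the partial sum raises its second moment by at most \<open>3 C\<close>: the cross terms form a
  geometric series of sum at most \<open>C\<close>. Hence the second moment of the sum grows at most linearly, that of the
  average tends to \<open>0\<close>, and convergence in \<open>L\<^sup>1\<close> of the squared averages gives an almost surely convergent
  subsequence.
\<close>

lemma weakly_correlated_average_tendsto_0:
  fixes Y :: "nat \<Rightarrow> 'w \<Rightarrow> real"
  assumes int: "\<And>i j. integrable P (\<lambda>\<omega>. Y i \<omega> * Y j \<omega>)"
    and cov: "\<And>i j. i \<le> j \<Longrightarrow> (\<integral>\<omega>. Y i \<omega> * Y j \<omega> \<partial>P) \<le> C / 2 ^ (j - i)"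
    and C: "0 \<le> C"
  shows "\<exists>r. strict_mono r \<and> (AE \<omega> in P. (\<lambda>k. (\<Sum>i<r k. Y i \<omega>) / real (r k)) \<longlonglongrightarrow> 0)"
proof -
  have int_sq: "integrable P (\<lambda>\<omega>. (\<Sum>i<N. Y i \<omega>)\<^sup>2)" for N
    unfolding power2_eq_square sum_product by (intro Bochner_Integration.integrable_sum int)
  have int_cross: "integrable P (\<lambda>\<omega>. (\<Sum>i<N. Y i \<omega>) * Y j \<omega>)" for N j
    unfolding sum_distrib_right by (intro Bochner_Integration.integrable_sum int)
  have second_moment: "(\<integral>\<omega>. (\<Sum>i<N. Y i \<omega>)\<^sup>2 \<partial>P) \<le> 3 * C * real N" for N
  proof (induction N)
    case (Suc N)
    have "(\<integral>\<omega>. (\<Sum>i<N. Y i \<omega>) * Y N \<omega> \<partial>P) = (\<Sum>i<N. \<integral>\<omega>. Y i \<omega> * Y N \<omega> \<partial>P)"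
      unfolding sum_distrib_right by (intro Bochner_Integration.integral_sum int)
    also have "\<dots> \<le> (\<Sum>i<N. C / 2 ^ (N - i))"
      by (intro sum_mono cov) simp
    also have "\<dots> = C * (\<Sum>i<N. (1/2) ^ (N - i))"
      by (simp add: sum_distrib_left power_divide)
    also have "(\<Sum>i<N. (1/2) ^ (N - i)) = (\<Sum>i<N. (1/2::real) ^ Suc i)"
      by (subst sum.nat_diff_reindex[symmetric]) (auto intro!: sum.cong simp: Suc_diff_Suc)
    also have "\<dots> = 1 - (1/2) ^ N"
      by (induction N) auto
    finally have cross: "(\<integral>\<omega>. (\<Sum>i<N. Y i \<omega>) * Y N \<omega> \<partial>P) \<le> C"
      using mult_left_mono[OF _ C, of "1 - (1 / 2) ^ N" 1] by simp
    have "(\<integral>\<omega>. (\<Sum>i<Suc N. Y i \<omega>)\<^sup>2 \<partial>P)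
      = (\<integral>\<omega>. (\<Sum>i<N. Y i \<omega>)\<^sup>2 + (2 * ((\<Sum>i<N. Y i \<omega>) * Y N \<omega>) + Y N \<omega> * Y N \<omega>) \<partial>P)"
      by (intro Bochner_Integration.integral_cong) (auto simp: power2_eq_square algebra_simps)
    also have "\<dots> = (\<integral>\<omega>. (\<Sum>i<N. Y i \<omega>)\<^sup>2 \<partial>P) + (2 * (\<integral>\<omega>. (\<Sum>i<N. Y i \<omega>) * Y N \<omega> \<partial>P)
        + (\<integral>\<omega>. Y N \<omega> * Y N \<omega> \<partial>P))"
      using int_sq int_cross int by simp
    also have "\<dots> \<le> 3 * C * real N + (2 * C + C)"
      using cov[of N N] Suc cross by (intro add_mono) auto
    finally show ?case by (simp add: algebra_simps)
  qed simp
  let ?u = "\<lambda>N \<omega>. ((\<Sum>i<N. Y i \<omega>) / real N)\<^sup>2"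
  have "(\<lambda>N. \<integral>\<omega>. norm (?u N \<omega>) \<partial>P) \<longlonglongrightarrow> 0"
  proof (rule tendsto_sandwich[OF _ _ tendsto_const])
    show "eventually (\<lambda>N. (\<integral>\<omega>. norm (?u N \<omega>) \<partial>P) \<le> 3 * C / real N) sequentially"
      using eventually_gt_at_top[of 0]
    proof eventually_elim
      case (elim N)
      have "(\<integral>\<omega>. norm (?u N \<omega>) \<partial>P) = (\<integral>\<omega>. (\<Sum>i<N. Y i \<omega>)\<^sup>2 \<partial>P) / (real N)\<^sup>2"
        by (simp add: power_divide)
      also have "\<dots> \<le> 3 * C * real N / (real N)\<^sup>2"
        by (intro divide_right_mono second_moment) simp
      finally show ?case using elim by (simp add: power2_eq_square)
    qed
    show "(\<lambda>N. 3 * C / real N) \<longlonglongrightarrow> 0"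
      using lim_const_over_n[of "3 * C"] by simp
  qed simp
  moreover have "integrable P (?u N)" for N
    unfolding power_divide using int_sq by simp
  ultimately obtain r where r: "strict_mono r" "AE \<omega> in P. (\<lambda>k. ?u (r k) \<omega>) \<longlonglongrightarrow> 0"
    using tendsto_L1_AE_subseq[of P ?u] by auto
  from r(2) have "AE \<omega> in P. (\<lambda>k. (\<Sum>i<r k. Y i \<omega>) / real (r k)) \<longlonglongrightarrow> 0"
  proof eventually_elim
    case (elim \<omega>)
    from tendsto_real_sqrt[OF elim] show ?case
      by (auto intro: tendsto_rabs_zero_cancel)
  qed
  with r(1) show ?thesis by blast
qed

section \<open>Measurability with respect to the configuration outside a set\<close>

lemma space_completed_subalgebra:
  assumes "space G = space P"
  shows "space (completed_subalgebra P G) = space P"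
  unfolding completed_subalgebra_def by (simp add: space_measure_of_conv)

text \<open>
  It is enough to agree almost surely with a \<open>G\<close>-measurable real function: each level set of \<open>h\<close> differs from one
  of \<open>h'\<close> by a subset of a fixed null set.
\<close>

lemma measurable_completed_subalgebra:
  fixes h :: "'w \<Rightarrow> nat"
  assumes G: "space G = space P" and h': "h' \<in> borel_measurable G"
    and ae: "AE \<omega> in P. real (h \<omega>) = h' \<omega>"
  shows "h \<in> measurable (completed_subalgebra P G) (count_space UNIV)"
proof -
  let ?N = "null_sets (completion P)"
  have sets_eq: "sets (completed_subalgebra P G) = sigma_sets (space P) (sets G \<union> ?N)"
    unfolding completed_subalgebra_def
    using sets.sets_into_space[of _ G] sets.sets_into_space[of _ "completion P"] G
    by (intro sets_measure_of) (auto simp: null_sets_def)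
  have basic: "A \<in> sets (completed_subalgebra P G)" if "A \<in> sets G \<union> ?N" for A
    unfolding sets_eq using that by (rule sigma_sets.Basic)
  obtain N where N: "N \<in> null_sets P" "{\<omega> \<in> space P. real (h \<omega>) \<noteq> h' \<omega>} \<subseteq> N"
    using ae by (auto elim!: AE_E simp: null_sets_def)
  show ?thesis
    unfolding measurable_count_space_eq2_countable space_completed_subalgebra[OF G]
  proof (intro conjI ballI)
    fix k
    have "h' -` {real k} \<inter> space G \<in> sets G"
      using h' by (rule measurable_sets) simp
    moreover have "N \<in> ?N" "h -` {k} \<inter> space P \<inter> N \<in> ?N"
      using N(1) null_sets_completion_iff2 by blast+
    ultimately have "(h' -` {real k} \<inter> space G - N) \<union> (h -` {k} \<inter> space P \<inter> N)
        \<in> sets (completed_subalgebra P G)"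
      by (intro sets.Un sets.Diff basic) auto
    also have "(h' -` {real k} \<inter> space G - N) \<union> (h -` {k} \<inter> space P \<inter> N) = h -` {k} \<inter> space P"
      using N(2) G by auto
    finally show "h -` {k} \<inter> space P \<in> sets (completed_subalgebra P G)" .
  qed simp
qed

lemma space_configuration_space: "space configuration_space = configurations"
  unfolding configuration_space_def by (simp add: space_measure_of_conv)

lemma measurable_card_configuration:
  assumes "C \<in> sets borel" "bounded C"
  shows "(\<lambda>A. card (A \<inter> C)) \<in> measurable configuration_space (count_space UNIV)"
  unfolding measurable_count_space_eq2_countable
proof (intro conjI ballI)
  fix k
  have "(\<lambda>A. card (A \<inter> C)) -` {k} \<inter> space configuration_space = {A \<in> configurations. card (A \<inter> C) = k}"
    by (auto simp: space_configuration_space)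
  also have "\<dots> \<in> sets configuration_space"
    unfolding configuration_space_def using assms by (intro in_measure_of) auto
  finally show "(\<lambda>A. card (A \<inter> C)) -` {k} \<inter> space configuration_space \<in> sets configuration_space" .
qed simp

lemma configurations_Diff: "A \<in> configurations \<Longrightarrow> A - B \<in> configurations"
  unfolding configurations_def by (auto intro: rev_finite_subset)

section \<open>First and second moments of counts in a determinantal process\<close>

lemma det_mat_2:
  "Determinant.det (Matrix.mat 2 2 f) = f (0, 0) * f (1, 1) - f (0, 1) * (f (1, 0) :: 'b::comm_ring_1)"
proof -
  let ?A = "Matrix.mat 2 2 f"
  have A: "?A \<in> carrier_mat 2 2" by simp
  have "Determinant.det ?A = (\<Sum>i<2. ?A $$ (i, 0) * cofactor ?A i 0)"
    by (rule laplace_expansion_column[OF A]) simp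
  also have "\<dots> = f (0, 0) * f (1, 1) - f (0, 1) * f (1, 0)"
    by (simp add: numeral_2_eq_2 cofactor_def mat_delete_def det_single algebra_simps)
  finally show ?thesis .
qed

lemma infsum_indicator_eq_card:
  fixes Q :: "'b set"
  assumes "finite {x \<in> T. x \<in> Q}"
  shows "(\<Sum>\<^sub>\<infinity>x\<in>T. indicator Q x :: complex) = of_nat (card {x \<in> T. x \<in> Q})"
proof -
  have "(\<Sum>\<^sub>\<infinity>x\<in>T. indicator Q x :: complex) = (\<Sum>\<^sub>\<infinity>x\<in>{x \<in> T. x \<in> Q}. 1)"
    by (rule infsum_cong_neutral) auto
  then show ?thesis using assms by simp
qed

lemma card_ordered_pairs:
  assumes "finite B" "A \<subseteq> B"
  shows "card {(a, b). a \<in> A \<and> b \<in> B \<and> a \<noteq> b} + card A = card A * card B"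
proof -
  have A: "finite A" using assms finite_subset by auto
  have "A \<times> B = {(a, b). a \<in> A \<and> b \<in> B \<and> a \<noteq> b} \<union> (\<lambda>a. (a, a)) ` A"
    using assms by auto
  moreover have "card \<dots> = card {(a, b). a \<in> A \<and> b \<in> B \<and> a \<noteq> b} + card ((\<lambda>a. (a, a)) ` A)"
  proof (rule card_Un_disjoint)
    show "finite {(a, b). a \<in> A \<and> b \<in> B \<and> a \<noteq> b}"
      by (rule finite_subset[of _ "A \<times> B"]) (use A assms in auto)
  qed (use A in auto)
  moreover have "card ((\<lambda>a. (a, a)) ` A) = card A"
    by (rule card_image) (auto simp: inj_on_def)
  ultimately show ?thesis using card_cartesian_product[of A B] by simp
qed

text \<open>
  Only the correlation functions of order one and two are extracted. Test functions are indicators of boxes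
  \<open>A\<close> and \<open>A \<times> B\<close>, for which the sum over tuples of distinct points is a cardinality.
\<close>

locale determinantal_process = sigma_finite_measure m
  for m :: "'a::{heine_borel, second_countable_topology} measure" +
  fixes K :: "'a \<Rightarrow> 'a \<Rightarrow> complex" and P :: "'w measure" and X :: "'w \<Rightarrow> 'a set"
  assumes sets_m: "sets m = sets borel"
    and K_measurable: "case_prod K \<in> borel_measurable (m \<Otimes>\<^sub>M m)"
    and X: "determinantal_point_process m K P X"
begin

sublocale prob_space P
  using X by (simp add: determinantal_point_process_def point_process_def)

lemma X_measurable: "X \<in> measurable P configuration_space"
  using X by (simp add: determinantal_point_process_def point_process_def)

lemma X_configuration: "\<omega> \<in> space P \<Longrightarrow> X \<omega> \<in> configurations"
  using measurable_space[OF X_measurable] by (simp add: space_configuration_space)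

lemma finite_X_Int_bounded:
  assumes "\<omega> \<in> space P" "bounded A"
  shows "finite (X \<omega> \<inter> A)"
proof -
  have "finite (X \<omega> \<inter> closure A)"
    using X_configuration[OF assms(1)] assms(2) by (simp add: configurations_def compact_closure)
  then show ?thesis by (rule finite_subset[rotated]) (use closure_subset in auto)
qed

sublocale prod: product_sigma_finite "\<lambda>_::nat. m"
  by standard

lemma correlation:
  assumes "n > 0" "compactly_supported_test_function m n \<phi>"
  shows "integrable (\<Pi>\<^sub>M i\<in>{..<n}. m) (\<lambda>y. \<phi> y * Determinant.det (Matrix.mat n n (\<lambda>(i, j). K (y i) (y j))))"
    and "has_bochner_integral P
      (\<lambda>\<omega>. \<Sum>\<^sub>\<infinity>x | x \<in> {..<n} \<rightarrow>\<^sub>E X \<omega> \<and> inj_on x {..<n}. \<phi> x)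
      (\<integral>y. \<phi> y * Determinant.det (Matrix.mat n n (\<lambda>(i, j). K (y i) (y j))) \<partial>(\<Pi>\<^sub>M i\<in>{..<n}. m))"
  using X assms unfolding determinantal_point_process_def Let_def by blast+

lemma has_integral_count:
  assumes A: "A \<in> sets borel" "bounded A"
  shows "has_bochner_integral P (\<lambda>\<omega>. of_nat (card (X \<omega> \<inter> A)) :: complex)
    (\<integral>x. indicator A x * K x x \<partial>m)"
proof -
  have [measurable]: "A \<in> sets m" using A by (simp add: sets_m)
  note K_measurable [measurable]
  let ?\<phi> = "\<lambda>x. indicator {x. x (0::nat) \<in> A} x :: complex"
  have "compactly_supported_test_function m 1 ?\<phi>"
    unfolding compactly_supported_test_function_def
  proof (intro conjI)
    have [measurable]: "(\<lambda>x. x 0) \<in> measurable (\<Pi>\<^sub>M i\<in>{..<1::nat}. m) m"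
      by (rule measurable_component_singleton) simp
    have "(\<lambda>x. indicator A (x 0) :: complex) \<in> borel_measurable (\<Pi>\<^sub>M i\<in>{..<1::nat}. m)"
      by measurable
    then show "?\<phi> \<in> borel_measurable (\<Pi>\<^sub>M i\<in>{..<1}. m)"
      by (simp add: indicator_def)
    show "bounded (?\<phi> ` ({..<1} \<rightarrow>\<^sub>E UNIV))"
      unfolding bounded_iff by (rule exI[of _ 1]) (auto simp: indicator_def)
    show "\<exists>K. compact K \<and> (\<forall>x\<in>{..<1} \<rightarrow>\<^sub>E UNIV. ?\<phi> x \<noteq> 0 \<longrightarrow> x \<in> {..<1} \<rightarrow>\<^sub>E K)"
      using A subsetD[OF closure_subset[of A]]
      by (intro exI[of _ "closure A"]) (auto simp: PiE_iff indicator_def compact_closure split: if_splits)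
  qed
  then have hbi: "has_bochner_integral P
      (\<lambda>\<omega>. \<Sum>\<^sub>\<infinity>x | x \<in> {..<1} \<rightarrow>\<^sub>E X \<omega> \<and> inj_on x {..<1}. ?\<phi> x)
      (\<integral>y. ?\<phi> y * Determinant.det (Matrix.mat 1 1 (\<lambda>(i, j). K (y i) (y j))) \<partial>(\<Pi>\<^sub>M i\<in>{..<1}. m))"
    by (intro correlation) simp
  have "(\<Sum>\<^sub>\<infinity>x | x \<in> {..<1} \<rightarrow>\<^sub>E X \<omega> \<and> inj_on x {..<1}. ?\<phi> x) = of_nat (card (X \<omega> \<inter> A))"
    if "\<omega> \<in> space P" for \<omega>
  proof -
    let ?T = "{x. x \<in> {..<1::nat} \<rightarrow>\<^sub>E X \<omega> \<and> inj_on x {..<1}}"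
    have bij: "bij_betw (\<lambda>x. x 0) {x \<in> ?T. x \<in> {x. x 0 \<in> A}} (X \<omega> \<inter> A)"
    proof (rule bij_betw_byWitness[where f' = "\<lambda>a. restrict (\<lambda>_. a) {..<1}"])
      show "\<forall>x\<in>{x \<in> ?T. x \<in> {x. x 0 \<in> A}}. restrict (\<lambda>_. x 0) {..<1} = x"
        by (auto simp: PiE_iff extensional_def fun_eq_iff)
      show "(\<lambda>a. restrict (\<lambda>_. a) {..<1}) ` (X \<omega> \<inter> A) \<subseteq> {x \<in> ?T. x \<in> {x. x 0 \<in> A}}"
        by (auto simp: PiE_iff inj_on_def)
    qed auto
    then have "finite {x \<in> ?T. x \<in> {x. x 0 \<in> A}}"
      using bij_betw_finite finite_X_Int_bounded[OF that A(2)] by blast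
    from infsum_indicator_eq_card[OF this] bij_betw_same_card[OF bij] show ?thesis by simp
  qed
  then have lhs: "has_bochner_integral P (\<lambda>\<omega>. of_nat (card (X \<omega> \<inter> A)) :: complex)
      (\<integral>y. ?\<phi> y * Determinant.det (Matrix.mat 1 1 (\<lambda>(i, j). K (y i) (y j))) \<partial>(\<Pi>\<^sub>M i\<in>{..<1}. m))"
    by (rule iffD1[OF has_bochner_integral_cong[OF refl _ refl] hbi])
  have "(\<integral>y. ?\<phi> y * Determinant.det (Matrix.mat 1 1 (\<lambda>(i, j). K (y i) (y j))) \<partial>(\<Pi>\<^sub>M i\<in>{..<1}. m))
      = (\<integral>y. indicator A (y 0) * K (y 0) (y 0) \<partial>(\<Pi>\<^sub>M i\<in>{0::nat}. m))"
    by (simp add: det_single lessThan_Suc) (simp add: indicator_def)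
  also have "\<dots> = (\<integral>x. indicator A x * K x x \<partial>m)"
    by (rule prod.product_integral_singleton) measurable
  finally show ?thesis using lhs by simp
qed

text \<open>
  For \<open>A \<subseteq> B\<close> the ordered pairs of distinct points in \<open>A \<times> B\<close> are all pairs except the diagonal ones, one for each
  point in \<open>A\<close>; hence the correction by the count of \<open>A\<close>.
\<close>

lemma has_integral_count_pairs:
  assumes A: "A \<in> sets borel" and B: "B \<in> sets borel" "bounded B" and AB: "A \<subseteq> B"
  shows "has_bochner_integral P
    (\<lambda>\<omega>. of_nat (card (X \<omega> \<inter> A)) * of_nat (card (X \<omega> \<inter> B)) - of_nat (card (X \<omega> \<inter> A)) :: complex)
    (\<integral>x. indicator A x * (\<integral>y. indicator B y * (K x x * K y y - K x y * K y x) \<partial>m) \<partial>m)"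
proof -
  have [measurable]: "A \<in> sets m" "B \<in> sets m" using A B by (simp_all add: sets_m)
  note K_measurable [measurable]
  let ?\<phi> = "\<lambda>x. indicator {x. x (0::nat) \<in> A \<and> x 1 \<in> B} x :: complex"
  let ?\<rho> = "\<lambda>y. ?\<phi> y * Determinant.det (Matrix.mat 2 2 (\<lambda>(i, j). K (y i) (y j)))"
  have "compactly_supported_test_function m 2 ?\<phi>"
    unfolding compactly_supported_test_function_def
  proof (intro conjI)
    have [measurable]: "(\<lambda>x. x 0) \<in> measurable (\<Pi>\<^sub>M i\<in>{..<2::nat}. m) m"
      "(\<lambda>x. x 1) \<in> measurable (\<Pi>\<^sub>M i\<in>{..<2::nat}. m) m"
      by (rule measurable_component_singleton, simp)+
    have "(\<lambda>x. indicator A (x 0) * indicator B (x 1) :: complex) \<in> borel_measurable (\<Pi>\<^sub>M i\<in>{..<2::nat}. m)"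
      by measurable
    also have "(\<lambda>x. indicator A (x 0) * indicator B (x 1) :: complex) = ?\<phi>"
      by (auto simp: indicator_def)
    finally show "?\<phi> \<in> borel_measurable (\<Pi>\<^sub>M i\<in>{..<2}. m)" .
    show "bounded (?\<phi> ` ({..<2} \<rightarrow>\<^sub>E UNIV))"
      unfolding bounded_iff by (rule exI[of _ 1]) (auto simp: indicator_def)
    show "\<exists>K. compact K \<and> (\<forall>x\<in>{..<2} \<rightarrow>\<^sub>E UNIV. ?\<phi> x \<noteq> 0 \<longrightarrow> x \<in> {..<2} \<rightarrow>\<^sub>E K)"
      using B subsetD[OF AB] subsetD[OF closure_subset[of B]]
      by (intro exI[of _ "closure B"])
        (auto simp: PiE_iff indicator_def compact_closure less_2_cases_iff split: if_splits)
  qed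
  then have int: "integrable (\<Pi>\<^sub>M i\<in>{..<2}. m) ?\<rho>"
    and hbi: "has_bochner_integral P
      (\<lambda>\<omega>. \<Sum>\<^sub>\<infinity>x | x \<in> {..<2} \<rightarrow>\<^sub>E X \<omega> \<and> inj_on x {..<2}. ?\<phi> x) (\<integral>y. ?\<rho> y \<partial>(\<Pi>\<^sub>M i\<in>{..<2}. m))"
    by (auto intro: correlation)
  have "(\<Sum>\<^sub>\<infinity>x | x \<in> {..<2} \<rightarrow>\<^sub>E X \<omega> \<and> inj_on x {..<2}. ?\<phi> x)
      = of_nat (card (X \<omega> \<inter> A)) * of_nat (card (X \<omega> \<inter> B)) - of_nat (card (X \<omega> \<inter> A))"
    if "\<omega> \<in> space P" for \<omega>
  proof -
    let ?T = "{x. x \<in> {..<2::nat} \<rightarrow>\<^sub>E X \<omega> \<and> inj_on x {..<2}}"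
    let ?D = "{(a, b). a \<in> X \<omega> \<inter> A \<and> b \<in> X \<omega> \<inter> B \<and> a \<noteq> b}"
    have finB: "finite (X \<omega> \<inter> B)" using that B(2) by (rule finite_X_Int_bounded)
    have bij: "bij_betw (\<lambda>x. (x 0, x 1)) {x \<in> ?T. x \<in> {x. x 0 \<in> A \<and> x 1 \<in> B}} ?D"
    proof (rule bij_betw_byWitness[where f' = "\<lambda>(a, b). restrict (\<lambda>i. if i = 0 then a else b) {..<2}"])
      show "\<forall>x\<in>{x \<in> ?T. x \<in> {x. x 0 \<in> A \<and> x 1 \<in> B}}.
          (case (x 0, x 1) of (a, b) \<Rightarrow> restrict (\<lambda>i. if i = 0 then a else b) {..<2}) = x"
        by (auto simp: PiE_iff extensional_def fun_eq_iff less_2_cases_iff)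
      show "(\<lambda>x. (x 0, x 1)) ` {x \<in> ?T. x \<in> {x. x 0 \<in> A \<and> x 1 \<in> B}} \<subseteq> ?D"
        by (auto simp: PiE_iff dest: inj_onD[where x = 0 and y = "Suc 0"])
      show "(\<lambda>(a, b). restrict (\<lambda>i. if i = 0 then a else b) {..<2}) ` ?D
          \<subseteq> {x \<in> ?T. x \<in> {x. x 0 \<in> A \<and> x 1 \<in> B}}"
        by (auto simp: inj_on_def less_2_cases_iff split: if_splits)
    qed auto
    have "finite ?D"
      by (rule finite_subset[of _ "(X \<omega> \<inter> B) \<times> (X \<omega> \<inter> B)"]) (use finB AB in auto)
    then have "finite {x \<in> ?T. x \<in> {x. x 0 \<in> A \<and> x 1 \<in> B}}"
      using bij_betw_finite[OF bij] by simp
    from infsum_indicator_eq_card[OF this] bij_betw_same_card[OF bij]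
    have "(\<Sum>\<^sub>\<infinity>x | x \<in> {..<2} \<rightarrow>\<^sub>E X \<omega> \<and> inj_on x {..<2}. ?\<phi> x) = of_nat (card ?D)" by simp
    moreover have "card ?D + card (X \<omega> \<inter> A) = card (X \<omega> \<inter> A) * card (X \<omega> \<inter> B)"
      by (rule card_ordered_pairs) (use finB AB in auto)
    from arg_cong[OF this, of "of_nat :: nat \<Rightarrow> complex"]
    have "(of_nat (card ?D) :: complex) + of_nat (card (X \<omega> \<inter> A))
        = of_nat (card (X \<omega> \<inter> A)) * of_nat (card (X \<omega> \<inter> B))"
      unfolding of_nat_add of_nat_mult .
    ultimately show ?thesis by (simp only: eq_diff_eq)
  qed
  then have lhs: "has_bochner_integral P
      (\<lambda>\<omega>. of_nat (card (X \<omega> \<inter> A)) * of_nat (card (X \<omega> \<inter> B)) - of_nat (card (X \<omega> \<inter> A)) :: complex)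
      (\<integral>y. ?\<rho> y \<partial>(\<Pi>\<^sub>M i\<in>{..<2}. m))"
    by (rule iffD1[OF has_bochner_integral_cong[OF refl _ refl] hbi])
  \<comment> \<open>The coordinate \<open>1\<close>, which runs through \<open>B\<close>, is integrated first.\<close>
  have two: "{..<2::nat} = insert 1 {0}" by auto
  have "(\<integral>y. ?\<rho> y \<partial>(\<Pi>\<^sub>M i\<in>{..<2}. m)) = (\<integral>x. (\<integral>y. ?\<rho> (x(1 := y)) \<partial>m) \<partial>(\<Pi>\<^sub>M i\<in>{0::nat}. m))"
    using int unfolding two by (intro prod.product_integral_insert) auto
  also have "\<dots> = (\<integral>x. (\<integral>y. indicator A (x 0) * (indicator B y *
      (K (x 0) (x 0) * K y y - K (x 0) y * K y (x 0))) \<partial>m) \<partial>(\<Pi>\<^sub>M i\<in>{0::nat}. m))"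
    unfolding det_mat_2 by (intro Bochner_Integration.integral_cong refl) (simp add: indicator_def)
  also have "\<dots> = (\<integral>x. indicator A (x 0) * (\<integral>y. indicator B y *
      (K (x 0) (x 0) * K y y - K (x 0) y * K y (x 0)) \<partial>m) \<partial>(\<Pi>\<^sub>M i\<in>{0::nat}. m))"
    by simp
  also have "\<dots> = (\<integral>x. indicator A x * (\<integral>y. indicator B y * (K x x * K y y - K x y * K y x) \<partial>m) \<partial>m)"
    by (rule prod.product_integral_singleton) measurable
  finally show ?thesis using lhs by simp
qed

end

section \<open>Number rigidity\<close>

context fourier_of_set
begin

lemma kernel_eq_fhat: "kernel_of_set m \<psi> S x y = fhat (x - y)"
  by (simp add: kernel_of_set_def fhat_def)

lemma cball_power_mono: "i \<le> j \<Longrightarrow> cball (0::'a) (real q ^ i) \<subseteq> cball 0 (real q ^ j)"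
  using q_gt_1 by (intro subset_cball power_increasing) auto

text \<open>
  The intensity is the constant \<open>f(0) = m(S)\<close>, and \<open>K(x, y) K(y, x) = \<bar>f(x - y)\<bar>\<^sup>2\<close>. The inner integral is constant on
  the smaller ball, since that is contained in the larger one.
\<close>

lemma kernel_pair_integral:
  assumes "i \<le> j"
  shows "(\<integral>x. indicator (cball 0 (real q ^ i)) x * (\<integral>y. indicator (cball 0 (real q ^ j)) y *
      (fhat (x - x) * fhat (y - y) - fhat (x - y) * fhat (y - x)) \<partial>m) \<partial>m)
    = complex_of_real (real q ^ i * ((measure m S)\<^sup>2 * real q ^ j - (measure m S - fourier_tail j)))"
proof -
  let ?s = "measure m S" and ?B = "\<lambda>n. cball (0::'a) (real q ^ n)"
  let ?c = "?s\<^sup>2 * real q ^ j - (?s - fourier_tail j)"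
  have ind: "integrable m (indicator (?B n) :: 'a \<Rightarrow> real)" for n
    using emeasure_cball_finite by simp
  have inner: "(\<integral>y. indicator (?B j) y * (fhat (x - x) * fhat (y - y) - fhat (x - y) * fhat (y - x)) \<partial>m)
      = of_real ?c" if x: "x \<in> ?B j" for x
  proof -
    have int: "integrable m (\<lambda>y. indicator (?B j) y * (cmod (fhat (x - y)))\<^sup>2)"
      using emeasure_cball_finite norm_fhat_le
      by (intro integrableI_bounded_set[where A = "?B j" and B = "?s\<^sup>2"])
        (auto simp: power_mono indicator_def)
    have "indicator (?B j) y * (fhat (x - x) * fhat (y - y) - fhat (x - y) * fhat (y - x))
        = complex_of_real (?s\<^sup>2 * indicator (?B j) y - indicator (?B j) y * (cmod (fhat (x - y)))\<^sup>2)" for y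
    proof -
      have "fhat (x - y) * fhat (y - x) = complex_of_real ((cmod (fhat (x - y)))\<^sup>2)"
        using fhat_minus[of "x - y"] complex_norm_square[of "fhat (x - y)"] by simp
      then show ?thesis by (simp add: fhat_0 indicator_def power2_eq_square)
    qed
    then have "(\<integral>y. indicator (?B j) y * (fhat (x - x) * fhat (y - y) - fhat (x - y) * fhat (y - x)) \<partial>m)
        = (\<integral>y. complex_of_real (?s\<^sup>2 * indicator (?B j) y - indicator (?B j) y * (cmod (fhat (x - y)))\<^sup>2) \<partial>m)"
      by (simp only:)
    also have "\<dots> = of_real (\<integral>y. ?s\<^sup>2 * indicator (?B j) y - indicator (?B j) y * (cmod (fhat (x - y)))\<^sup>2 \<partial>m)"
      by (rule integral_complex_of_real)
    also have "(\<integral>y. ?s\<^sup>2 * indicator (?B j) y - indicator (?B j) y * (cmod (fhat (x - y)))\<^sup>2 \<partial>m) = ?c"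
      by (subst Bochner_Integration.integral_diff[OF integrable_mult_right[OF ind] int])
        (simp add: integral_cball_translate[OF x] measure_cball_large)
    finally show ?thesis .
  qed
  have "indicator (?B i) x * (\<integral>y. indicator (?B j) y *
      (fhat (x - x) * fhat (y - y) - fhat (x - y) * fhat (y - x)) \<partial>m)
      = complex_of_real (?c * indicator (?B i) x)" for x
    using inner[of x] cball_power_mono[OF assms] by (simp add: indicator_def subset_eq del: mem_cball)
  then have "(\<integral>x. indicator (?B i) x * (\<integral>y. indicator (?B j) y *
      (fhat (x - x) * fhat (y - y) - fhat (x - y) * fhat (y - x)) \<partial>m) \<partial>m)
      = (\<integral>x. complex_of_real (?c * indicator (?B i) x) \<partial>m)"
    by (simp only:)
  also have "\<dots> = of_real (\<integral>x. ?c * indicator (?B i) x \<partial>m)"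
    by (rule integral_complex_of_real)
  also have "(\<integral>x. ?c * indicator (?B i) x \<partial>m) = real q ^ i * ?c"
    by (simp add: measure_cball_large)
  finally show ?thesis .
qed

lemma kernel_diag_integral:
  "(\<integral>x. indicator (cball 0 (real q ^ i)) x * fhat (x - x) \<partial>m)
    = complex_of_real (measure m S * real q ^ i)"
proof -
  have "(\<integral>x. indicator (cball 0 (real q ^ i)) x * fhat (x - x) \<partial>m)
    = (\<integral>x. complex_of_real (measure m S * indicator (cball 0 (real q ^ i)) x) \<partial>m)"
    by (intro Bochner_Integration.integral_cong) (auto simp: fhat_0 indicator_def)
  also have "\<dots> = of_real (\<integral>x. measure m S * indicator (cball 0 (real q ^ i)) x \<partial>m)"
    by (rule integral_complex_of_real)
  finally show ?thesis by (simp add: measure_cball_large)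
qed

context
  fixes P :: "'w measure" and X :: "'w \<Rightarrow> 'a set"
  assumes X: "determinantal_point_process m (kernel_of_set m \<psi> S) P X"
begin

interpretation D: determinantal_process m "kernel_of_set m \<psi> S" P X
proof
  show "(\<lambda>(x, y). kernel_of_set m \<psi> S x y) \<in> borel_measurable (m \<Otimes>\<^sub>M m)"
    unfolding kernel_eq_fhat by measurable
qed (use X in auto)

definition ball_count :: "nat \<Rightarrow> 'w \<Rightarrow> real" where
  "ball_count n \<omega> = real (card (X \<omega> \<inter> cball 0 (real q ^ n)))"

lemma has_integral_ball_count: "has_bochner_integral P (ball_count n) (measure m S * real q ^ n)"
  using has_bochner_integral_Re[OF D.has_integral_count[of "cball 0 (real q ^ n)"]]
  unfolding kernel_eq_fhat kernel_diag_integral by (simp add: ball_count_def[abs_def])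

lemma has_integral_ball_count_mult:
  assumes "i \<le> j"
  shows "has_bochner_integral P (\<lambda>\<omega>. ball_count i \<omega> * ball_count j \<omega>)
    ((measure m S)\<^sup>2 * real q ^ i * real q ^ j + real q ^ i * fourier_tail j)"
proof -
  let ?s = "measure m S"
  have "has_bochner_integral P (\<lambda>\<omega>. ball_count i \<omega> * ball_count j \<omega> - ball_count i \<omega>)
      (real q ^ i * (?s\<^sup>2 * real q ^ j - (?s - fourier_tail j)))"
    using has_bochner_integral_Re[OF D.has_integral_count_pairs[of "cball 0 (real q ^ i)" "cball 0 (real q ^ j)"]]
      cball_power_mono[OF assms]
    unfolding kernel_eq_fhat kernel_pair_integral[OF assms] by (simp add: ball_count_def[abs_def])
  from has_bochner_integral_add[OF this has_integral_ball_count[of i]]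
  show ?thesis by (simp add: algebra_simps)
qed

text \<open>
  The exact covariance. The larger ball contributes the tail of \<open>\<bar>f\<bar>\<^sup>2\<close>, the smaller one its volume.
\<close>

lemma covariance_count:
  assumes "i \<le> j"
  shows "has_bochner_integral P
      (\<lambda>\<omega>. (ball_count i \<omega> - measure m S * real q ^ i) * (ball_count j \<omega> - measure m S * real q ^ j))
      (real q ^ i * fourier_tail j)"
proof -
  let ?s = "measure m S"
  have const: "has_bochner_integral P (\<lambda>_. c) c" for c :: real
    by (simp add: has_bochner_integral_iff D.prob_space)
  have "has_bochner_integral P
      (\<lambda>\<omega>. (ball_count i \<omega> * ball_count j \<omega> - ?s * real q ^ i * ball_count j \<omega>)
        - (?s * real q ^ j * ball_count i \<omega> - ?s * real q ^ i * (?s * real q ^ j)))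
      ((?s\<^sup>2 * real q ^ i * real q ^ j + real q ^ i * fourier_tail j - ?s * real q ^ i * (?s * real q ^ j))
        - (?s * real q ^ j * (?s * real q ^ i) - ?s * real q ^ i * (?s * real q ^ j)))"
    by (intro has_bochner_integral_diff has_bochner_integral_mult_right has_integral_ball_count
        has_integral_ball_count_mult assms const)
  then show ?thesis by (simp add: algebra_simps power2_eq_square)
qed

text \<open>
  All balls \<open>B(0, q\<^bsup>n0 + i\<^esup>)\<close> contain \<open>B\<close>, and \<open>n0\<close> is so large that the decay bound holds from there on. Since the
  centred counts average out along a subsequence, the count in \<open>B\<close>, a summand common to all of them, is recovered
  from the counts of the points outside \<open>B\<close>.
\<close>

lemma number_rigid_of_decay:
  assumes decay: "fourier_tail \<in> O(\<lambda>n. 1 / real q ^ n)"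
  shows "number_rigid P X"
  unfolding number_rigid_def
proof (intro allI impI)
  fix B :: "'a set" assume "open B \<and> bounded B"
  then have B: "bounded B" by simp
  let ?s = "measure m S"
  obtain c where c: "c > 0" "eventually (\<lambda>n. norm (fourier_tail n) \<le> c * norm (1 / real q ^ n)) sequentially"
    using decay by (rule landau_o.bigE)
  then obtain n1 where n1: "\<And>n. n \<ge> n1 \<Longrightarrow> fourier_tail n \<le> c / real q ^ n"
    by (force simp: eventually_sequentially abs_le_iff)
  obtain R where R: "\<And>x. x \<in> B \<Longrightarrow> dist 0 x \<le> R"
    using B unfolding bounded_any_center[of _ 0] by auto
  obtain n2 where n2: "R < real q ^ n2"
    using real_arch_pow[of "real q"] q_gt_1 by auto
  define n0 where "n0 = max n1 n2"
  have B_subset: "B \<subseteq> cball 0 (real q ^ (n0 + i))" for i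
  proof
    fix x assume "x \<in> B"
    moreover have "real q ^ n2 \<le> real q ^ (n0 + i)"
      using q_gt_1 by (intro power_increasing) (auto simp: n0_def)
    ultimately show "x \<in> cball 0 (real q ^ (n0 + i))"
      using R[of x] n2 by simp
  qed
  define Y where "Y i \<omega> = ball_count (n0 + i) \<omega> - ?s * real q ^ (n0 + i)" for i \<omega>
  have hY: "has_bochner_integral P (\<lambda>\<omega>. Y i \<omega> * Y j \<omega>) (real q ^ (n0 + i) * fourier_tail (n0 + j))"
    if "i \<le> j" for i j
    unfolding Y_def using that by (intro covariance_count) simp
  have int: "integrable P (\<lambda>\<omega>. Y i \<omega> * Y j \<omega>)" for i j
    using hY[of i j] hY[of j i] by (cases "i \<le> j") (auto simp: has_bochner_integral_iff mult.commute)
  have cov: "(\<integral>\<omega>. Y i \<omega> * Y j \<omega> \<partial>P) \<le> c / 2 ^ (j - i)" if ij: "i \<le> j" for i j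
  proof -
    have "(\<integral>\<omega>. Y i \<omega> * Y j \<omega> \<partial>P) = real q ^ (n0 + i) * fourier_tail (n0 + j)"
      using hY[OF ij] by (simp add: has_bochner_integral_iff)
    also have "\<dots> \<le> real q ^ (n0 + i) * (c / real q ^ (n0 + j))"
      by (intro mult_left_mono n1) (auto simp: n0_def)
    also have "\<dots> = c / real q ^ (j - i)"
    proof -
      have "real q ^ (n0 + j) = real q ^ (n0 + i) * real q ^ (j - i)"
        using ij by (simp flip: power_add)
      then show ?thesis using q_gt_1 by simp
    qed
    also have "\<dots> \<le> c / 2 ^ (j - i)"
      using c(1) q_gt_1 by (intro divide_left_mono power_mono) auto
    finally show ?thesis .
  qed
  obtain r where r: "strict_mono r" "AE \<omega> in P. (\<lambda>k. (\<Sum>i<r k. Y i \<omega>) / real (r k)) \<longlonglongrightarrow> 0"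
    using weakly_correlated_average_tendsto_0[of P Y c, OF int cov] c(1) by auto
  define outside where "outside i \<omega> = card ((X \<omega> - B) \<inter> cball 0 (real q ^ (n0 + i)))" for i \<omega>
  \<comment> \<open>The limit exists almost surely; elsewhere \<open>lim\<close> has an arbitrary value, on a null set only.\<close>
  define h where "h \<omega> = lim (\<lambda>k. (\<Sum>i<r k. ?s * real q ^ (n0 + i) - real (outside i \<omega>)) / real (r k))" for \<omega>
  let ?G = "vimage_algebra (space P) (\<lambda>\<omega>. X \<omega> - B) configuration_space"
  have "(\<lambda>\<omega>. X \<omega> - B) \<in> measurable ?G configuration_space"
    by (rule measurable_vimage_algebra1)
      (auto simp: space_configuration_space intro: configurations_Diff D.X_configuration)
  then have "outside i \<in> measurable ?G (count_space UNIV)" for i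
    unfolding outside_def[abs_def] by (rule measurable_compose) (simp add: measurable_card_configuration)
  then have [measurable]: "(\<lambda>\<omega>. real (outside i \<omega>)) \<in> borel_measurable ?G" for i
    by (rule measurable_compose) simp
  have "h \<in> borel_measurable ?G"
    unfolding h_def[abs_def] by measurable
  moreover have "AE \<omega> in P. real (card (X \<omega> \<inter> B)) = h \<omega>"
    using r(2) AE_space
  proof eventually_elim
    case (elim \<omega>)
    let ?b = "real (card (X \<omega> \<inter> B))"
    have split: "Y i \<omega> = ?b - (?s * real q ^ (n0 + i) - real (outside i \<omega>))" for i
    proof -
      let ?C = "cball (0::'a) (real q ^ (n0 + i))"
      have fin: "finite (X \<omega> \<inter> ?C)" using elim by (intro D.finite_X_Int_bounded) auto
      have "X \<omega> \<inter> ?C = (X \<omega> \<inter> B) \<union> (X \<omega> - B) \<inter> ?C" using B_subset[of i] by auto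
      moreover have "card ((X \<omega> \<inter> B) \<union> (X \<omega> - B) \<inter> ?C) = card (X \<omega> \<inter> B) + card ((X \<omega> - B) \<inter> ?C)"
        by (rule card_Un_disjoint) (use fin B_subset[of i] in \<open>auto intro: rev_finite_subset\<close>)
      ultimately show ?thesis by (simp add: Y_def ball_count_def outside_def)
    qed
    have "(\<lambda>k. ?b - (\<Sum>i<r k. Y i \<omega>) / real (r k)) \<longlonglongrightarrow> ?b - 0"
      by (intro tendsto_diff tendsto_const elim)
    moreover have "eventually (\<lambda>k. ?b - (\<Sum>i<r k. Y i \<omega>) / real (r k)
        = (\<Sum>i<r k. ?s * real q ^ (n0 + i) - real (outside i \<omega>)) / real (r k)) sequentially"
      using eventually_gt_at_top[of 0]
    proof eventually_elim
      case (elim k)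
      then have "r k > 0" using seq_suble[OF r(1), of k] by simp
      then show ?case
        unfolding split by (simp add: sum_subtractf sum.distrib field_simps)
    qed
    ultimately have "(\<lambda>k. (\<Sum>i<r k. ?s * real q ^ (n0 + i) - real (outside i \<omega>)) / real (r k)) \<longlonglongrightarrow> ?b - 0"
      by (rule Lim_transform_eventually)
    then show ?case unfolding h_def by (simp add: limI)
  qed
  ultimately show "(\<lambda>\<omega>. card (X \<omega> \<inter> B)) \<in> measurable (completed_subalgebra P ?G) (count_space UNIV)"
    by (intro measurable_completed_subalgebra) simp_all
qed

end
end

theorem theorem1p3:
  fixes m :: "'a::nonarch_local_field measure"
    and \<pi> :: 'a
    and \<psi> :: "'a \<Rightarrow> complex"
    and S :: "'a set"
    and q :: nat
    and P :: "'w measure"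
    and X :: "'w \<Rightarrow> 'a set"
  assumes q: "q = residue_card TYPE('a)"
    and \<pi>: "uniformizer \<pi>"
    and m: "normalized_haar_measure m"
    and \<psi>: "additive_character \<psi>"
    and \<psi>_trivial: "\<forall>x\<in>\<O>\<^sub>F. \<psi> x = 1"
    and \<psi>_nontrivial: "\<not> \<psi> constant_on ((\<lambda>x. inverse \<pi> * x) ` \<O>\<^sub>F)"
    and S: "S \<in> sets m" "0 < emeasure m S" "emeasure m S < \<infinity>"
    and decay: "(\<lambda>n::nat. LINT y:(UNIV - cball 0 (real q ^ n))|m.
                   (cmod (fourier m \<psi> (indicator S) y))\<^sup>2)
                \<in> O(\<lambda>n. 1 / real q ^ n)"
    and X: "determinantal_point_process m (kernel_of_set m \<psi> S) P X"
  shows "number_rigid P X"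
proof -
  interpret local_field_fourier m \<pi> \<psi> q
    by standard fact+
  interpret fourier_of_set m \<pi> \<psi> q S
    by standard (use S in auto)
  show ?thesis
    using X decay by (intro number_rigid_of_decay) (simp_all add: fourier_tail_def[abs_def] fhat_def)
qed

end
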